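(* Let $K$ be a field, $I$ a finite set and $q\in(K^* )^I$. Up to isomorphism of $K$-algebras, the multiplicative preprojective algebra $\Lambda^q(Q,<)$ of a finite quiver $Q$ with vertex set $I$ does not depend on the orientation of $Q$ or on the chosen total ordering $<$ on the arrows of the double $\overline{Q}$. That is, if $Q'$ is obtained from $Q$ by reversing the direction of some of its arrows, and $<$, $<'$ are any total orderings on the sets of arrows of $\overline{Q}$ and $\overline{Q'}$ respectively, then $\Lambda^q(Q,<)\cong\Lambda^q(Q',<')$.
   Context: For a finite quiver $Q$ with vertex set $I$, arrows $a$ have head $h(a)$ and tail $t(a)$. The path algebra $KQ$ has as basis the paths $a_1\cdots a_n$ with $t(a_i)=h(a_{i+1})$ together with trivial paths $e_v$ ($v\in I$). The double $\overline{Q}$ is obtained from $Q$ by adjoining a reverse arrow $a^*$ for each arrow $a\in Q$; $a\mapsto a^*$ is extended to an involution by $(a^* )^*=a$; $\epsilon(a)=1$ if $a\in Q$ and $\epsilon(a)=-1$ if $a^*\in Q$. Fix a total ordering $<$ on the arrows of $\overline{Q}$, say $a_1<a_2<\dots<a_n$, and $q=(q_v)\in(K^* )^I$. The multiplicative preprojective algebra $\Lambda^q=\Lambda^q(Q,<)$ is the target of the universal $K$-algebra homomorphism $K\overline{Q}\to R$ such that $1+aa^*$ is invertible in $R$ for all $a\in\overline{Q}$ and $$(1+a_1a_1^* )^{\epsilon(a_1)}(1+a_2a_2^* )^{\epsilon(a_2)}\cdots(1+a_na_n^* )^{\epsilon(a_n)}=\sum_{v\in I}q_ve_v\quad\text{in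 }R.$$ Equivalently, adjoin inverses of all $1+aa^*$ to $K\overline{Q}$ and factor out the displayed relation. *)

theory Defs
  imports "HOL-Algebra.QuotRing" "HOL-Algebra.Module" "Graph_Theory.Digraph" "Graph_Theory.Arc_Walk"
begin

text \<open>
  The base field is a type \<open>'k :: field\<close>. An associative unital \<open>K\<close>-algebra, not necessarily
  commutative, is a ring in the sense of HOL-Algebra with a scalar multiplication by \<open>'k\<close>; the
  record type \<open>module\<close> provides these operations. (The library locale \<open>algebra\<close> is restricted
  to commutative algebras.)
\<close>

definition alg_iso :: "('k :: field, 'a) module \<Rightarrow> ('k, 'b) module \<Rightarrow> bool" where
  "alg_iso A B \<longleftrightarrow>
     (\<exists>f \<in> ring_iso A B. \<forall>c. \<forall>x \<in> carrier A. f (c \<odot>\<^bsub>A\<^esub> x) = c \<odot>\<^bsub>B\<^esub> f x)"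

definition quot_algebra :: "('k :: field, 'a) module \<Rightarrow> 'a set \<Rightarrow> ('k, 'a set) module" where
  "quot_algebra A J =
     \<lparr>carrier = carrier (A Quot J), mult = mult (A Quot J), one = one (A Quot J),
      zero = zero (A Quot J), add = add (A Quot J),
      smult = (\<lambda>c X. \<Union>x\<in>X. J +>\<^bsub>A\<^esub> (c \<odot>\<^bsub>A\<^esub> x))\<rparr>"


section \<open>Quivers and path algebras\<close>

text \<open>
  A finite quiver is a \<open>fin_digraph\<close>: loops and parallel arrows are allowed.

  The path \<open>a\<^sub>1 \<cdots> a\<^sub>n\<close> with \<open>t(a\<^sub>i) = h(a\<^sub>i\<^sub>+\<^sub>1)\<close> is encoded as
  \<open>(h(a\<^sub>1), [a\<^sub>1, \<dots>, a\<^sub>n], t(a\<^sub>n))\<close>, and the trivial path \<open>e\<^sub>v\<close> as \<open>(v, [], v)\<close>.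
  Arrows compose from right to left, whereas \<open>awalk\<close> lists the arcs in the order in which they
  are traversed; hence the reversal.
\<close>

type_synonym ('v, 'e) path = "'v \<times> 'e list \<times> 'v"

definition paths :: "('v, 'e) pre_digraph \<Rightarrow> ('v, 'e) path set" where
  "paths Q = {(u, as, w). pre_digraph.awalk Q w (rev as) u}"

fun trivial_path :: "('v, 'e) path \<Rightarrow> bool" where
  "trivial_path (u, as, w) \<longleftrightarrow> as = []"

fun composable :: "('v, 'e) path \<Rightarrow> ('v, 'e) path \<Rightarrow> bool" where
  "composable (u, as, w) (u', as', w') \<longleftrightarrow> w = u'"

fun path_comp :: "('v, 'e) path \<Rightarrow> ('v, 'e) path \<Rightarrow> ('v, 'e) path" where
  "path_comp (u, as, w) (u', as', w') = (u, as @ as', w')"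

text \<open>
  Elements of the path algebra are the finitely supported coefficient functions on paths. The
  index set in the convolution product is finite for every path \<open>p\<close>. The given unit belongs to
  the carrier, and is the unit element, when \<open>Q\<close> has finitely many vertices; there may be
  infinitely many arrows.
\<close>

definition path_algebra :: "('v, 'e) pre_digraph \<Rightarrow> ('k :: field, ('v, 'e) path \<Rightarrow> 'k) module" where
  "path_algebra Q =
     \<lparr>carrier = {f. finite {p. f p \<noteq> 0} \<and> {p. f p \<noteq> 0} \<subseteq> paths Q},
      mult = (\<lambda>f g p. \<Sum>(r, s) | r \<in> paths Q \<and> s \<in> paths Q \<and> composable r s \<and> path_comp r s = p.
                 f r * g s),
      one = (\<lambda>p. if p \<in> paths Q \<and> trivial_path p then 1 else 0),
      zero = (\<lambda>p. 0),
      add = (\<lambda>f g p. f p + g p),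
      smult = (\<lambda>c f p. c * f p)\<rparr>"

definition path_basis :: "('v, 'e) path \<Rightarrow> ('v, 'e) path \<Rightarrow> 'k :: field" where
  "path_basis p = (\<lambda>r. if r = p then 1 else 0)"

definition idem :: "'v \<Rightarrow> ('v, 'e) path \<Rightarrow> 'k :: field" where
  "idem v = path_basis (v, [], v)"

definition arrow :: "('v, 'e) pre_digraph \<Rightarrow> 'e \<Rightarrow> ('v, 'e) path \<Rightarrow> 'k :: field" where
  "arrow Q a = path_basis (head Q a, [a], tail Q a)"


section \<open>Adjoining inverses\<close>

text \<open>The free algebra on \<open>X\<close> is the path algebra of the quiver with one vertex and loop set \<open>X\<close>.\<close>

definition loops :: "'x set \<Rightarrow> (unit, 'x) pre_digraph" where
  "loops X = \<lparr>verts = {()}, arcs = X, tail = (\<lambda>_. ()), head = (\<lambda>_. ())\<rparr>"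

definition free_algebra :: "'x set \<Rightarrow> ('k :: field, (unit, 'x) path \<Rightarrow> 'k) module" where
  "free_algebra X = path_algebra (loops X)"

definition gen :: "'x \<Rightarrow> (unit, 'x) path \<Rightarrow> 'k :: field" where
  "gen x = path_basis ((), [x], ())"

text \<open>
  The universal localization of \<open>A\<close> at \<open>S\<close> is presented by generators \<open>Inl a\<close> for \<open>a \<in> A\<close>,
  subject to all relations that hold in \<open>A\<close>, and generators \<open>Inr s\<close> for \<open>s \<in> S\<close>, which are
  required to be inverse to the \<open>Inl s\<close>. The structure map \<open>A \<rightarrow> A[S\<^sup>-\<^sup>1]\<close> is \<open>inverses_map A S\<close>;
  it need not be injective.
\<close>

type_synonym ('k, 'a) free_inv = "(unit, 'a + 'a) path \<Rightarrow> 'k"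

definition inverses_relations ::
    "('k :: field, 'a) module \<Rightarrow> 'a set \<Rightarrow> ('k, 'a) free_inv set" where
  "inverses_relations A S =
     (let F = free_algebra (carrier A <+> S) in
        {gen (Inl (a \<oplus>\<^bsub>A\<^esub> b)) \<ominus>\<^bsub>F\<^esub> (gen (Inl a) \<oplus>\<^bsub>F\<^esub> gen (Inl b)) | a b.
           a \<in> carrier A \<and> b \<in> carrier A} \<union>
        {gen (Inl (a \<otimes>\<^bsub>A\<^esub> b)) \<ominus>\<^bsub>F\<^esub> (gen (Inl a) \<otimes>\<^bsub>F\<^esub> gen (Inl b)) | a b.
           a \<in> carrier A \<and> b \<in> carrier A} \<union>
        {gen (Inl (c \<odot>\<^bsub>A\<^esub> a)) \<ominus>\<^bsub>F\<^esub> (c \<odot>\<^bsub>F\<^esub> gen (Inl a)) | c a. a \<in> carrier A} \<union>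
        {gen (Inl \<one>\<^bsub>A\<^esub>) \<ominus>\<^bsub>F\<^esub> \<one>\<^bsub>F\<^esub>} \<union>
        {(gen (Inl s) \<otimes>\<^bsub>F\<^esub> gen (Inr s)) \<ominus>\<^bsub>F\<^esub> \<one>\<^bsub>F\<^esub> | s. s \<in> S} \<union>
        {(gen (Inr s) \<otimes>\<^bsub>F\<^esub> gen (Inl s)) \<ominus>\<^bsub>F\<^esub> \<one>\<^bsub>F\<^esub> | s. s \<in> S})"

definition inverses_ideal ::
    "('k :: field, 'a) module \<Rightarrow> 'a set \<Rightarrow> ('k, 'a) free_inv set" where
  "inverses_ideal A S =
     genideal (free_algebra (carrier A <+> S)) (inverses_relations A S)"

definition adjoin_inverses ::
    "('k :: field, 'a) module \<Rightarrow> 'a set \<Rightarrow> ('k, ('k, 'a) free_inv set) module" where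
  "adjoin_inverses A S =
     quot_algebra (free_algebra (carrier A <+> S)) (inverses_ideal A S)"

definition inverses_map ::
    "('k :: field, 'a) module \<Rightarrow> 'a set \<Rightarrow> 'a \<Rightarrow> ('k, 'a) free_inv set" where
  "inverses_map A S a =
     inverses_ideal A S +>\<^bsub>(free_algebra (carrier A <+> S) :: ('k, ('k, 'a) free_inv) module)\<^esub>
       gen (Inl a)"


section \<open>Multiplicative preprojective algebras\<close>

text \<open>The arrow \<open>a\<close> of \<open>Q\<close> becomes \<open>Inl a\<close> in the double, and its reverse \<open>a\<^sup>*\<close> is \<open>Inr a\<close>.\<close>

definition double :: "('v, 'e) pre_digraph \<Rightarrow> ('v, 'e + 'e) pre_digraph" where
  "double Q =
     \<lparr>verts = verts Q, arcs = arcs Q <+> arcs Q,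
      tail = case_sum (tail Q) (head Q), head = case_sum (head Q) (tail Q)\<rparr>"

fun star :: "'e + 'e \<Rightarrow> 'e + 'e" where
  "star (Inl a) = Inr a"
| "star (Inr a) = Inl a"

fun sgn_arrow :: "'e + 'e \<Rightarrow> int" where
  "sgn_arrow (Inl a) = 1"
| "sgn_arrow (Inr a) = -1"

definition one_plus :: "('v, 'e) pre_digraph \<Rightarrow> 'e + 'e \<Rightarrow> ('v, 'e + 'e) path \<Rightarrow> 'k :: field" where
  "one_plus Q a =
     (let P = path_algebra (double Q) in
        \<one>\<^bsub>P\<^esub> \<oplus>\<^bsub>P\<^esub> (arrow (double Q) a \<otimes>\<^bsub>P\<^esub> arrow (double Q) (star a)))"

definition increasing_list :: "'a set \<Rightarrow> 'a rel \<Rightarrow> 'a list" where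
  "increasing_list A r =
     (THE xs. set xs = A \<and> distinct xs \<and> sorted_wrt (\<lambda>x y. (x, y) \<in> r) xs)"

definition mult_preproj ::
    "('v, 'e) pre_digraph \<Rightarrow> ('e + 'e) rel \<Rightarrow> ('v \<Rightarrow> 'k :: field) \<Rightarrow>
       ('k, ('k, ('v, 'e + 'e) path \<Rightarrow> 'k) free_inv set set) module" where
  "mult_preproj Q r q =
     (let P = path_algebra (double Q);
          S = one_plus Q ` arcs (double Q);
          L = adjoin_inverses P S;
          \<iota> = inverses_map P S;
          factors = map (\<lambda>a. \<iota> (one_plus Q a) [^]\<^bsub>L\<^esub> sgn_arrow a) (increasing_list (arcs (double Q)) r);
          lhs = foldr (\<lambda>x y. x \<otimes>\<^bsub>L\<^esub> y) factors \<one>\<^bsub>L\<^esub>;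
          rhs = \<iota> (\<Oplus>\<^bsub>P\<^esub>v\<in>verts Q. q v \<odot>\<^bsub>P\<^esub> idem v)
      in quot_algebra L (genideal L {lhs \<ominus>\<^bsub>L\<^esub> rhs}))"

definition reverse_arrows :: "'e set \<Rightarrow> ('v, 'e) pre_digraph \<Rightarrow> ('v, 'e) pre_digraph" where
  "reverse_arrows X Q =
     \<lparr>verts = verts Q, arcs = arcs Q,
      tail = (\<lambda>a. if a \<in> X then head Q a else tail Q a),
      head = (\<lambda>a. if a \<in> X then tail Q a else head Q a)\<rparr>"

end

theory Submission
  imports Defs
begin

text \<open>
  The algebra \<open>\<Lambda>\<^sup>q(Q, <)\<close> represents the functor of families \<open>(E, A)\<close> of idempotents and arrows in a
  \<open>K\<close>-algebra that satisfy the defining relation. Hence it suffices to transform such families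
  naturally and invertibly into families for another quiver or ordering; the algebra itself
  stays fixed and only its universal family changes.

  Each factor \<open>1 + a a\<^sup>*\<close> commutes with the idempotents, so the relation may be rotated cyclically.
  Neighbouring factors of \<open>a\<close> and \<open>b \<noteq> a\<^sup>*\<close> are exchanged by \<open>a \<mapsto> c\<inverse> a\<close>, \<open>a\<^sup>* \<mapsto> a\<^sup>* c\<close>, where \<open>c\<close> is
  \<open>1 + b b\<^sup>*\<close> or its inverse, depending on the sign of \<open>b\<close>. To move \<open>a\<close> past \<open>a\<^sup>*\<close> one lets it travel around the circle in the other direction.
  An arrow is reversed by \<open>(a, a\<^sup>*) \<mapsto> (a\<^sup>*, - (1 + a a\<^sup>*)\<inverse> a)\<close>, which inverts \<open>1 + a a\<^sup>*\<close> and \<open>1 + a\<^sup>* a\<close>.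
\<close>

subsection \<open>Associative algebras\<close>

text \<open>A change of family is useful only if the old family can be recovered from the new one by
  a formula that every homomorphism respects. This dictates the choices. The exchange of
  \<open>a\<close> and \<open>b\<close> conjugates the factor of \<open>a\<close> by the signed
  factor of \<open>b\<close>; the latter is unchanged itself, so it can be read off from either
  family. The reversal turns factors into inverses, so the old factors are again at hand. The
  idempotents are never altered. The cyclic symmetry comes from the right side of the relation: a
  combination of the idempotents commutes with every partial product of the left side, hence two
  complementary partial products commute with each other. Reversal keeps the order of the factors,
  because the inverted factor and the opposite sign compensate. The ordering prescribed for the new
  quiver is then a matter of permutation alone.\<close>

locale k_algebra = ring R for R :: "('k::field, 'a) module" (structure) +
  assumes smult_closed [simp, intro]: "x \<in> carrier R \<Longrightarrow> c \<odot> x \<in> carrier R"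
    and smult_l_distr: "x \<in> carrier R \<Longrightarrow> (c + d) \<odot> x = c \<odot> x \<oplus> d \<odot> x"
    and smult_r_distr: "x \<in> carrier R \<Longrightarrow> y \<in> carrier R \<Longrightarrow> c \<odot> (x \<oplus> y) = c \<odot> x \<oplus> c \<odot> y"
    and smult_smult: "x \<in> carrier R \<Longrightarrow> (c * d) \<odot> x = c \<odot> (d \<odot> x)"
    and smult_one [simp]: "x \<in> carrier R \<Longrightarrow> 1 \<odot> x = x"
    and smult_mult_l: "x \<in> carrier R \<Longrightarrow> y \<in> carrier R \<Longrightarrow> (c \<odot> x) \<otimes> y = c \<odot> (x \<otimes> y)"
    and smult_mult_r: "x \<in> carrier R \<Longrightarrow> y \<in> carrier R \<Longrightarrow> x \<otimes> (c \<odot> y) = c \<odot> (x \<otimes> y)"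
begin

lemma smult_zero_left [simp]: "x \<in> carrier R \<Longrightarrow> 0 \<odot> x = \<zero>"
  using smult_l_distr[of x 0 0] add.r_cancel_one by (metis add_0 smult_closed)

lemma smult_zero_right [simp]: "c \<odot> \<zero> = \<zero>"
  using smult_r_distr[of \<zero> \<zero> c] add.r_cancel_one by (metis r_zero smult_closed zero_closed)

lemma minus_self [simp]: "x \<in> carrier R \<Longrightarrow> x \<ominus> x = \<zero>"
  by (simp add: a_minus_def r_neg)

end

text \<open>The axioms are equations together with the existence of negatives, so they pass to the
  image of a map that respects the operations. For quotients this replaces computations with
  cosets.\<close>

lemma k_algebraI_surj:
  assumes A: "k_algebra A"
    and onto: "carrier B = f ` carrier A"
    and add: "\<And>x y. x \<in> carrier A \<Longrightarrow> y \<in> carrier A \<Longrightarrow> f x \<oplus>\<^bsub>B\<^esub> f y = f (x \<oplus>\<^bsub>A\<^esub> y)"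
    and mult: "\<And>x y. x \<in> carrier A \<Longrightarrow> y \<in> carrier A \<Longrightarrow> f x \<otimes>\<^bsub>B\<^esub> f y = f (x \<otimes>\<^bsub>A\<^esub> y)"
    and smult: "\<And>c x. x \<in> carrier A \<Longrightarrow> c \<odot>\<^bsub>B\<^esub> f x = f (c \<odot>\<^bsub>A\<^esub> x)"
    and one: "\<one>\<^bsub>B\<^esub> = f \<one>\<^bsub>A\<^esub>"
    and zero: "\<zero>\<^bsub>B\<^esub> = f \<zero>\<^bsub>A\<^esub>"
  shows "k_algebra B"
proof -
  interpret A: k_algebra A by (rule A)
  show ?thesis
    unfolding k_algebra_def k_algebra_axioms_def
  proof (intro conjI allI impI ringI abelian_groupI monoidI)
    show "\<exists>y\<in>carrier B. y \<oplus>\<^bsub>B\<^esub> x = \<zero>\<^bsub>B\<^esub>" if x: "x \<in> carrier B" for x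
    proof -
      obtain a where a: "a \<in> carrier A" "x = f a" using x onto by auto
      then have "f (\<ominus>\<^bsub>A\<^esub> a) \<oplus>\<^bsub>B\<^esub> x = \<zero>\<^bsub>B\<^esub>" by (simp add: add zero A.l_neg)
      with a onto show ?thesis by auto
    qed
    show "x \<oplus>\<^bsub>B\<^esub> y = y \<oplus>\<^bsub>B\<^esub> x" if "x \<in> carrier B" "y \<in> carrier B" for x y
      using that by (auto simp: onto add A.a_comm)
  qed (auto simp: onto add mult smult one zero A.m_assoc A.a_assoc A.l_distr A.r_distr
      A.smult_l_distr A.smult_r_distr A.smult_smult A.smult_mult_l A.smult_mult_r)
qed

locale algebra_hom = A?: k_algebra A + B?: k_algebra B
  for A :: "('k::field, 'a) module" and B :: "('k, 'b) module" and f +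
  assumes hom_ring: "f \<in> ring_hom A B"
    and hom_smult: "x \<in> carrier A \<Longrightarrow> f (c \<odot>\<^bsub>A\<^esub> x) = c \<odot>\<^bsub>B\<^esub> f x"

sublocale algebra_hom \<subseteq> ring_hom_ring A B f
  by (intro ring_hom_ring.intro ring_hom_ring_axioms.intro A.ring_axioms B.ring_axioms hom_ring)

context algebra_hom
begin

lemma hom_minus: "x \<in> carrier A \<Longrightarrow> y \<in> carrier A \<Longrightarrow> f (x \<ominus>\<^bsub>A\<^esub> y) = f x \<ominus>\<^bsub>B\<^esub> f y"
  by (simp add: a_minus_def)

lemma hom_sum:
  "(\<And>i. i \<in> I \<Longrightarrow> g i \<in> carrier A) \<Longrightarrow> f (\<Oplus>\<^bsub>A\<^esub>i\<in>I. g i) = (\<Oplus>\<^bsub>B\<^esub>i\<in>I. f (g i))"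
proof (induction I rule: infinite_finite_induct)
  case (insert x F)
  then show ?case by (simp add: A.finsum_insert B.finsum_insert Pi_def)
qed auto

lemma hom_unit: "x \<in> Units A \<Longrightarrow> f x \<in> Units B"
  unfolding Units_def by (auto, metis hom_closed hom_mult hom_one)

lemma hom_inv:
  assumes "x \<in> Units A" shows "f (inv\<^bsub>A\<^esub> x) = inv\<^bsub>B\<^esub> f x"
proof -
  have "f (inv\<^bsub>A\<^esub> x) \<otimes>\<^bsub>B\<^esub> f x = \<one>\<^bsub>B\<^esub>" "f x \<otimes>\<^bsub>B\<^esub> f (inv\<^bsub>A\<^esub> x) = \<one>\<^bsub>B\<^esub>"
    using assms by (simp_all add: hom_mult[symmetric] A.Units_closed)
  with assms show ?thesis
    by (metis A.Units_closed A.Units_inv_closed B.inv_char hom_closed)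
qed

lemma hom_foldr_mult:
  "set xs \<subseteq> carrier A \<Longrightarrow>
    f (foldr (\<lambda>x y. x \<otimes>\<^bsub>A\<^esub> y) xs \<one>\<^bsub>A\<^esub>) = foldr (\<lambda>x y. x \<otimes>\<^bsub>B\<^esub> y) (map f xs) \<one>\<^bsub>B\<^esub>"
proof -
  have "set xs \<subseteq> carrier A \<Longrightarrow> foldr (\<lambda>x y. x \<otimes>\<^bsub>A\<^esub> y) xs \<one>\<^bsub>A\<^esub> \<in> carrier A" for xs
    by (induction xs) auto
  then show "set xs \<subseteq> carrier A \<Longrightarrow> ?thesis" by (induction xs) auto
qed

end

lemma algebra_homI:
  assumes "k_algebra A" "k_algebra B"
    and "\<And>x. x \<in> carrier A \<Longrightarrow> f x \<in> carrier B"
    and "\<And>x y. x \<in> carrier A \<Longrightarrow> y \<in> carrier A \<Longrightarrow> f (x \<otimes>\<^bsub>A\<^esub> y) = f x \<otimes>\<^bsub>B\<^esub> f y"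
    and "\<And>x y. x \<in> carrier A \<Longrightarrow> y \<in> carrier A \<Longrightarrow> f (x \<oplus>\<^bsub>A\<^esub> y) = f x \<oplus>\<^bsub>B\<^esub> f y"
    and "f \<one>\<^bsub>A\<^esub> = \<one>\<^bsub>B\<^esub>"
    and "\<And>c x. x \<in> carrier A \<Longrightarrow> f (c \<odot>\<^bsub>A\<^esub> x) = c \<odot>\<^bsub>B\<^esub> f x"
  shows "algebra_hom A B f"
  by (intro algebra_hom.intro algebra_hom_axioms.intro assms ring_hom_memI)

lemma algebra_hom_comp:
  assumes "algebra_hom A B f" "algebra_hom B C g"
  shows "algebra_hom A C (g \<circ> f)"
proof -
  interpret f: algebra_hom A B f by fact
  interpret g: algebra_hom B C g by fact
  show ?thesis
    by (rule algebra_homI)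
      (auto simp: f.k_algebra_axioms g.B.k_algebra_axioms f.hom_smult g.hom_smult
        intro: f.A.k_algebra_axioms)
qed

lemma algebra_hom_id: "k_algebra A \<Longrightarrow> algebra_hom A A id"
  by (rule algebra_homI) auto

subsection \<open>Quotients\<close>

text \<open>The scalar action on cosets is a union over representatives. All of them give the same
  coset: since \<open>c \<odot> j\<close> is the product of \<open>c \<odot> \<one>\<close> and
  \<open>j\<close>, a ring ideal is automatically stable under scalars.\<close>

lemma quot_algebra_smult:
  assumes "k_algebra A" "ideal J A" "x \<in> carrier A"
  shows "c \<odot>\<^bsub>quot_algebra A J\<^esub> (J +>\<^bsub>A\<^esub> x) = J +>\<^bsub>A\<^esub> (c \<odot>\<^bsub>A\<^esub> x)"
proof -
  interpret A: k_algebra A by fact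
  interpret J: ideal J A by fact
  have "J +>\<^bsub>A\<^esub> (c \<odot>\<^bsub>A\<^esub> y) = J +>\<^bsub>A\<^esub> (c \<odot>\<^bsub>A\<^esub> x)" if y: "y \<in> J +>\<^bsub>A\<^esub> x" for y
  proof -
    obtain j where j: "j \<in> J" "y = j \<oplus>\<^bsub>A\<^esub> x"
      using y unfolding a_r_coset_def' by blast
    have jA: "j \<in> carrier A" by (simp add: j J.a_Hcarr)
    have "(c \<odot>\<^bsub>A\<^esub> \<one>\<^bsub>A\<^esub>) \<otimes>\<^bsub>A\<^esub> j \<in> J" by (rule J.I_l_closed) (simp_all add: j)
    then have "c \<odot>\<^bsub>A\<^esub> j \<in> J" using jA by (simp add: A.smult_mult_l)
    then have "c \<odot>\<^bsub>A\<^esub> j \<oplus>\<^bsub>A\<^esub> c \<odot>\<^bsub>A\<^esub> x \<in> J +>\<^bsub>A\<^esub> (c \<odot>\<^bsub>A\<^esub> x)"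
      by (rule A.a_rcosI) (simp_all add: J.a_subset assms(3))
    then show ?thesis
      using jA assms(3)
      by (simp add: j A.smult_r_distr A.a_repr_independence[OF _ _ J.a_subgroup, symmetric])
  qed
  then have "(\<Union>y\<in>J +>\<^bsub>A\<^esub> x. J +>\<^bsub>A\<^esub> (c \<odot>\<^bsub>A\<^esub> y)) = (\<Union>y\<in>J +>\<^bsub>A\<^esub> x. J +>\<^bsub>A\<^esub> (c \<odot>\<^bsub>A\<^esub> x))"
    by (rule SUP_cong[OF refl])
  moreover have "x \<in> J +>\<^bsub>A\<^esub> x" by (rule J.a_rcos_self) fact
  ultimately show ?thesis by (simp add: quot_algebra_def) blast
qed

lemma quot_algebra_simps:
  assumes "k_algebra A" "ideal J A"
  shows "carrier (quot_algebra A J) = (\<lambda>x. J +>\<^bsub>A\<^esub> x) ` carrier A"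
    and "\<one>\<^bsub>quot_algebra A J\<^esub> = J +>\<^bsub>A\<^esub> \<one>\<^bsub>A\<^esub>"
    and "\<zero>\<^bsub>quot_algebra A J\<^esub> = J +>\<^bsub>A\<^esub> \<zero>\<^bsub>A\<^esub>"
    and "x \<in> carrier A \<Longrightarrow> y \<in> carrier A \<Longrightarrow>
      (J +>\<^bsub>A\<^esub> x) \<oplus>\<^bsub>quot_algebra A J\<^esub> (J +>\<^bsub>A\<^esub> y) = J +>\<^bsub>A\<^esub> (x \<oplus>\<^bsub>A\<^esub> y)"
    and "x \<in> carrier A \<Longrightarrow> y \<in> carrier A \<Longrightarrow>
      (J +>\<^bsub>A\<^esub> x) \<otimes>\<^bsub>quot_algebra A J\<^esub> (J +>\<^bsub>A\<^esub> y) = J +>\<^bsub>A\<^esub> (x \<otimes>\<^bsub>A\<^esub> y)"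
proof -
  interpret A: k_algebra A by fact
  interpret J: ideal J A by fact
  show "carrier (quot_algebra A J) = (\<lambda>x. J +>\<^bsub>A\<^esub> x) ` carrier A"
    "\<one>\<^bsub>quot_algebra A J\<^esub> = J +>\<^bsub>A\<^esub> \<one>\<^bsub>A\<^esub>"
    "\<zero>\<^bsub>quot_algebra A J\<^esub> = J +>\<^bsub>A\<^esub> \<zero>\<^bsub>A\<^esub>"
    by (auto simp: quot_algebra_def FactRing_def A_RCOSETS_def' J.a_subset)
  show "x \<in> carrier A \<Longrightarrow> y \<in> carrier A \<Longrightarrow>
      (J +>\<^bsub>A\<^esub> x) \<oplus>\<^bsub>quot_algebra A J\<^esub> (J +>\<^bsub>A\<^esub> y) = J +>\<^bsub>A\<^esub> (x \<oplus>\<^bsub>A\<^esub> y)"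
    "x \<in> carrier A \<Longrightarrow> y \<in> carrier A \<Longrightarrow>
      (J +>\<^bsub>A\<^esub> x) \<otimes>\<^bsub>quot_algebra A J\<^esub> (J +>\<^bsub>A\<^esub> y) = J +>\<^bsub>A\<^esub> (x \<otimes>\<^bsub>A\<^esub> y)"
    by (auto simp: quot_algebra_def FactRing_def J.a_rcos_sum J.rcoset_mult_add)
qed

lemma quot_algebra_hom:
  assumes "k_algebra A" "ideal J A"
  shows "algebra_hom A (quot_algebra A J) (\<lambda>x. J +>\<^bsub>A\<^esub> x)"
proof (rule algebra_homI)
  show "k_algebra (quot_algebra A J)"
    by (rule k_algebraI_surj[where f = "\<lambda>x. J +>\<^bsub>A\<^esub> x"])
      (use assms in \<open>simp_all add: quot_algebra_simps quot_algebra_smult\<close>)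
qed (use assms in \<open>simp_all add: quot_algebra_simps quot_algebra_smult\<close>)

lemma quot_algebra_factor:
  assumes f: "algebra_hom A B f" and J: "ideal J A"
    and ker: "\<And>x. x \<in> J \<Longrightarrow> f x = \<zero>\<^bsub>B\<^esub>"
  shows "\<exists>g. algebra_hom (quot_algebra A J) B g \<and> (\<forall>x\<in>carrier A. g (J +>\<^bsub>A\<^esub> x) = f x)"
proof -
  interpret algebra_hom A B f by fact
  interpret J: ideal J A by fact
  \<comment> \<open>An arbitrary representative will do, because \<open>f\<close> kills
    \<open>J\<close> and is therefore constant on each coset.\<close>
  define g where "g X = f (SOME x. x \<in> X)" for X
  have g: "g (J +>\<^bsub>A\<^esub> x) = f x" if "x \<in> carrier A" for x
  proof -
    have "x \<in> J +>\<^bsub>A\<^esub> x" by (rule J.a_rcos_self) fact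
    then have "(SOME y. y \<in> J +>\<^bsub>A\<^esub> x) \<in> J +>\<^bsub>A\<^esub> x" by (rule someI)
    then obtain j where j: "j \<in> J" "(SOME y. y \<in> J +>\<^bsub>A\<^esub> x) = j \<oplus>\<^bsub>A\<^esub> x"
      unfolding a_r_coset_def' by blast
    show ?thesis unfolding g_def j(2) using that j(1) by (simp add: ker J.a_Hcarr)
  qed
  have "algebra_hom A (quot_algebra A J) (\<lambda>x. J +>\<^bsub>A\<^esub> x)"
    by (rule quot_algebra_hom) (rule A.k_algebra_axioms J)+
  then have q: "k_algebra (quot_algebra A J)" by (simp add: algebra_hom_def)
  have "algebra_hom (quot_algebra A J) B g"
    by (rule algebra_homI[OF q B.k_algebra_axioms])
      (auto simp: quot_algebra_simps[OF A.k_algebra_axioms J]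
         quot_algebra_smult[OF A.k_algebra_axioms J] g hom_smult)
  with g show ?thesis by blast
qed

text \<open>The kernel of \<open>f\<close> is an ideal, so it contains \<open>genideal A T\<close>
  as soon as it contains \<open>T\<close>.\<close>

lemma quot_genideal_factor:
  assumes f: "algebra_hom A B f" and T: "T \<subseteq> carrier A"
    and ker: "\<And>x. x \<in> T \<Longrightarrow> f x = \<zero>\<^bsub>B\<^esub>"
  shows "\<exists>g. algebra_hom (quot_algebra A (genideal A T)) B g \<and>
    (\<forall>x\<in>carrier A. g (genideal A T +>\<^bsub>A\<^esub> x) = f x)"
proof -
  interpret algebra_hom A B f by fact
  have "genideal A T \<subseteq> a_kernel A B f"
  proof (rule A.genideal_minimal[OF kernel_is_ideal], rule subsetI)
    fix x assume "x \<in> T"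
    with T have "x \<in> carrier A" by (rule subsetD)
    with ker[OF \<open>x \<in> T\<close>] show "x \<in> a_kernel A B f" unfolding a_kernel_def' by simp
  qed
  then have "f x = \<zero>\<^bsub>B\<^esub>" if "x \<in> genideal A T" for x
    using that by (intro kernel_zero) (rule subsetD)
  then show ?thesis by (rule quot_algebra_factor[OF f A.genideal_ideal[OF T]])
qed

lemma quot_genideal_eq:
  assumes "k_algebra A" "T \<subseteq> carrier A" "x \<in> carrier A" "y \<in> carrier A" "x \<ominus>\<^bsub>A\<^esub> y \<in> T"
  shows "genideal A T +>\<^bsub>A\<^esub> x = genideal A T +>\<^bsub>A\<^esub> y"
proof -
  interpret A: k_algebra A by (rule assms)
  have "x \<ominus>\<^bsub>A\<^esub> y \<in> genideal A T" by (rule subsetD[OF A.genideal_self[OF assms(2)] assms(5)])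
  then show ?thesis
    by (rule iffD1[OF A.quotient_eq_iff_same_a_r_cos[OF A.genideal_ideal[OF assms(2)] assms(3,4)]])
qed

subsection \<open>Path algebras\<close>

text \<open>Infinitely many arrows are allowed because free algebras, which are path algebras on one
  vertex, are formed on whole carriers. Finiteness of the vertex set gives \<open>\<one>\<close>
  finite support and keeps the convolution sums finite.\<close>

locale fin_quiver = wf_digraph Q for Q :: "('v, 'e) pre_digraph" (structure) +
  assumes finite_verts: "finite (verts Q)"
begin

lemma paths_Nil [simp]: "(u, [], w) \<in> paths Q \<longleftrightarrow> u = w \<and> u \<in> verts Q"
  by (auto simp: paths_def awalk_def)

lemma paths_Cons [simp]:
  "(u, a # as, w) \<in> paths Q \<longleftrightarrow> a \<in> arcs Q \<and> head Q a = u \<and> (tail Q a, as, w) \<in> paths Q"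
proof -
  \<comment> \<open>The first arrow of an encoded path is the last arc of the walk, so
    \<open>cas\<close> has to be unrolled at its right end.\<close>
  have "cas w (bs @ [a]) u \<longleftrightarrow> cas w bs (tail Q a) \<and> head Q a = u" for bs w
    by (induction bs arbitrary: w) auto
  then show ?thesis by (auto simp: paths_def awalk_def)
qed

lemma paths_endpoints: "(u, as, w) \<in> paths Q \<Longrightarrow> u \<in> verts Q \<and> w \<in> verts Q"
  by (induction as arbitrary: u) auto

lemma append_in_paths:
  "(u, as, w) \<in> paths Q \<Longrightarrow> (w, bs, z) \<in> paths Q \<Longrightarrow> (u, as @ bs, z) \<in> paths Q"
  by (induction as arbitrary: u) auto

lemma path_comp_in_paths:
  "r \<in> paths Q \<Longrightarrow> s \<in> paths Q \<Longrightarrow> composable r s \<Longrightarrow> path_comp r s \<in> paths Q"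
  by (cases r; cases s) (auto intro: append_in_paths)

definition decomp :: "('v, 'e) path \<Rightarrow> (('v, 'e) path \<times> ('v, 'e) path) set" where
  "decomp p = {(r, s). r \<in> paths Q \<and> s \<in> paths Q \<and> composable r s \<and> path_comp r s = p}"

text \<open>A factorisation of a path is determined by the position of the cut and the vertex at the
  cut.\<close>

lemma finite_decomp: "finite (decomp p)"
proof -
  obtain u as w where p: "p = (u, as, w)" by (cases p) auto
  have "decomp p \<subseteq> (\<lambda>(k, x). ((u, take k as, x), (x, drop k as, w))) ` ({..length as} \<times> verts Q)"
  proof
    fix rs assume "rs \<in> decomp p"
    then obtain bs x cs where rs: "rs = ((u, bs, x), (x, cs, w))" "as = bs @ cs" "(u, bs, x) \<in> paths Q"
      by (cases rs) (auto simp: decomp_def p)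
    then show "rs \<in> (\<lambda>(k, x). ((u, take k as, x), (x, drop k as, w))) ` ({..length as} \<times> verts Q)"
      by (intro image_eqI[where x = "(length bs, x)"]) (auto dest: paths_endpoints)
  qed
  then show ?thesis by (rule finite_subset) (simp add: finite_verts)
qed

lemma decomp_empty: "p \<notin> paths Q \<Longrightarrow> decomp p = {}"
  by (auto simp: decomp_def dest: append_in_paths)

abbreviation PA :: "('k::field, ('v, 'e) path \<Rightarrow> 'k) module" where
  "PA \<equiv> path_algebra Q"

lemma PA_carrier: "f \<in> carrier PA \<longleftrightarrow> finite {p. f p \<noteq> 0} \<and> {p. f p \<noteq> 0} \<subseteq> paths Q"
  by (simp add: path_algebra_def)

lemma PA_mult: "(f \<otimes>\<^bsub>PA\<^esub> g) p = (\<Sum>(r, s)\<in>decomp p. f r * g s)"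
  by (simp add: path_algebra_def decomp_def)

lemma PA_ops:
  "f \<oplus>\<^bsub>PA\<^esub> g = (\<lambda>p. f p + g p)" "\<zero>\<^bsub>PA\<^esub> = (\<lambda>p. 0)" "c \<odot>\<^bsub>PA\<^esub> f = (\<lambda>p. c * f p)"
  "\<one>\<^bsub>PA\<^esub> = (\<lambda>p. if p \<in> paths Q \<and> trivial_path p then 1 else 0)"
  by (simp_all add: path_algebra_def)

lemma PA_add_closed: "f \<in> carrier PA \<Longrightarrow> g \<in> carrier PA \<Longrightarrow> f \<oplus>\<^bsub>PA\<^esub> g \<in> carrier PA"
proof -
  assume fg: "f \<in> carrier PA" "g \<in> carrier PA"
  have "{p. f p + g p \<noteq> 0} \<subseteq> {p. f p \<noteq> 0} \<union> {p. g p \<noteq> 0}" by auto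
  then show ?thesis using fg unfolding PA_carrier PA_ops
    by (meson finite_Un finite_subset le_sup_iff order_trans)
qed

lemma PA_smult_closed: "f \<in> carrier PA \<Longrightarrow> c \<odot>\<^bsub>PA\<^esub> f \<in> carrier PA"
  by (auto simp: PA_carrier PA_ops elim: rev_finite_subset)

lemma PA_zero_closed: "\<zero>\<^bsub>PA\<^esub> \<in> carrier PA"
  by (simp add: PA_carrier PA_ops)

lemma path_basis_closed: "p \<in> paths Q \<Longrightarrow> path_basis p \<in> carrier PA"
  by (simp add: PA_carrier path_basis_def)

lemma PA_mult_closed:
  assumes "f \<in> carrier PA" "g \<in> carrier PA" shows "f \<otimes>\<^bsub>PA\<^esub> g \<in> carrier PA"
proof -
  have sub: "{p. (f \<otimes>\<^bsub>PA\<^esub> g) p \<noteq> 0} \<subseteq> (\<lambda>(r, s). path_comp r s) ` ({p. f p \<noteq> 0} \<times> {p. g p \<noteq> 0})"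
  proof
    fix p assume "p \<in> {p. (f \<otimes>\<^bsub>PA\<^esub> g) p \<noteq> 0}"
    then have "(\<Sum>(r, s)\<in>decomp p. f r * g s) \<noteq> 0" by (simp add: PA_mult)
    then obtain rs where "rs \<in> decomp p" "(case rs of (r, s) \<Rightarrow> f r * g s) \<noteq> 0"
      by (rule sum.not_neutral_contains_not_neutral)
    then show "p \<in> (\<lambda>(r, s). path_comp r s) ` ({p. f p \<noteq> 0} \<times> {p. g p \<noteq> 0})"
      by (intro image_eqI[where x = rs]) (auto simp: decomp_def)
  qed
  have "finite {p. (f \<otimes>\<^bsub>PA\<^esub> g) p \<noteq> 0}"
    by (rule finite_subset[OF sub]) (use assms in \<open>simp add: PA_carrier\<close>)
  moreover have "{p. (f \<otimes>\<^bsub>PA\<^esub> g) p \<noteq> 0} \<subseteq> paths Q"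
  proof (rule subsetI, rule ccontr)
    fix p assume "p \<in> {p. (f \<otimes>\<^bsub>PA\<^esub> g) p \<noteq> 0}" "p \<notin> paths Q"
    then show False by (simp add: PA_mult decomp_empty)
  qed
  ultimately show ?thesis by (simp add: PA_carrier)
qed

lemma PA_l_distr: "(f \<oplus>\<^bsub>PA\<^esub> g) \<otimes>\<^bsub>PA\<^esub> h = (f \<otimes>\<^bsub>PA\<^esub> h) \<oplus>\<^bsub>PA\<^esub> (g \<otimes>\<^bsub>PA\<^esub> h)"
  by (rule ext) (simp add: PA_mult PA_ops split_def distrib_right sum.distrib)

lemma PA_r_distr: "h \<otimes>\<^bsub>PA\<^esub> (f \<oplus>\<^bsub>PA\<^esub> g) = (h \<otimes>\<^bsub>PA\<^esub> f) \<oplus>\<^bsub>PA\<^esub> (h \<otimes>\<^bsub>PA\<^esub> g)"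
  by (rule ext) (simp add: PA_mult PA_ops split_def distrib_left sum.distrib)

lemma PA_smult_l: "(c \<odot>\<^bsub>PA\<^esub> f) \<otimes>\<^bsub>PA\<^esub> g = c \<odot>\<^bsub>PA\<^esub> (f \<otimes>\<^bsub>PA\<^esub> g)"
  by (rule ext) (simp add: PA_mult PA_ops split_def sum_distrib_left mult_ac)

lemma PA_smult_r: "f \<otimes>\<^bsub>PA\<^esub> (c \<odot>\<^bsub>PA\<^esub> g) = c \<odot>\<^bsub>PA\<^esub> (f \<otimes>\<^bsub>PA\<^esub> g)"
  by (rule ext) (simp add: PA_mult PA_ops split_def sum_distrib_left mult_ac)

lemma PA_zero_mult: "\<zero>\<^bsub>PA\<^esub> \<otimes>\<^bsub>PA\<^esub> f = \<zero>\<^bsub>PA\<^esub>" "f \<otimes>\<^bsub>PA\<^esub> \<zero>\<^bsub>PA\<^esub> = \<zero>\<^bsub>PA\<^esub>"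
  by (rule ext, simp add: PA_mult PA_ops)+

text \<open>Reduces multilinear identities to basis paths without handling sums over supports. The
  induction runs over a finite set bounding the support; clearing one coefficient shrinks the
  bound.\<close>

lemma PA_induct [consumes 1, case_names zero step]:
  fixes f :: "('v, 'e) path \<Rightarrow> 'k::field"
  assumes "f \<in> carrier PA"
    and zero: "P \<zero>\<^bsub>PA\<^esub>"
    and step: "\<And>c p f. p \<in> paths Q \<Longrightarrow> f \<in> carrier PA \<Longrightarrow> P f \<Longrightarrow>
      P ((c \<odot>\<^bsub>PA\<^esub> path_basis p) \<oplus>\<^bsub>PA\<^esub> f)"
  shows "P f"
proof -
  have "finite S \<Longrightarrow> S \<subseteq> paths Q \<Longrightarrow> {p. f p \<noteq> 0} \<subseteq> S \<Longrightarrow> P f"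
    for S and f :: "('v, 'e) path \<Rightarrow> 'k"
  proof (induction S arbitrary: f rule: finite_induct)
    case empty
    then have "f = \<zero>\<^bsub>PA\<^esub>" by (auto simp: PA_ops)
    then show ?case by (simp add: zero)
  next
    case (insert p S)
    have "{q. (f(p := 0)) q \<noteq> 0} \<subseteq> S" using insert.prems by auto
    then have "P (f(p := 0))" "f(p := 0) \<in> carrier PA"
      unfolding PA_carrier using insert finite_subset[of _ S] by blast+
    then have "P ((f p \<odot>\<^bsub>PA\<^esub> path_basis p) \<oplus>\<^bsub>PA\<^esub> f(p := 0))"
      using insert.prems by (intro step) auto
    also have "(f p \<odot>\<^bsub>PA\<^esub> path_basis p) \<oplus>\<^bsub>PA\<^esub> f(p := 0) = f"
      by (rule ext) (simp add: PA_ops path_basis_def)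
    finally show ?case .
  qed
  with assms(1) show ?thesis by (auto simp: PA_carrier)
qed

lemma path_basis_mult:
  assumes "r \<in> paths Q" "s \<in> paths Q"
  shows "path_basis r \<otimes>\<^bsub>PA\<^esub> path_basis s =
    (if composable r s then path_basis (path_comp r s) else \<zero>\<^bsub>PA\<^esub>)"
proof (rule ext)
  fix p
  have "(path_basis r \<otimes>\<^bsub>PA\<^esub> path_basis s) p =
      (\<Sum>x\<in>decomp p. if x = (r, s) then 1 else 0)"
    unfolding PA_mult by (rule sum.cong) (auto simp: path_basis_def split: if_splits)
  then show "(path_basis r \<otimes>\<^bsub>PA\<^esub> path_basis s) p =
      (if composable r s then path_basis (path_comp r s) else \<zero>\<^bsub>PA\<^esub>) p"
    using assms finite_decomp[of p] by (auto simp: decomp_def path_basis_def PA_ops)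
qed

lemma path_basis_assoc:
  assumes "r \<in> paths Q" "s \<in> paths Q" "t \<in> paths Q"
  shows "(path_basis r \<otimes>\<^bsub>PA\<^esub> path_basis s) \<otimes>\<^bsub>PA\<^esub> path_basis t =
    path_basis r \<otimes>\<^bsub>PA\<^esub> (path_basis s \<otimes>\<^bsub>PA\<^esub> path_basis t)"
proof -
  have "composable (path_comp r s) t = composable s t" "composable r (path_comp s t) = composable r s"
    "path_comp (path_comp r s) t = path_comp r (path_comp s t)"
    by (cases r; cases s; cases t; simp)+
  then show ?thesis
    using assms by (simp add: path_basis_mult path_comp_in_paths PA_zero_mult)
qed

text \<open>Both sides are trilinear, so three nested inductions reduce the claim to basis paths.
  This avoids a bijection between the two kinds of threefold decompositions.\<close>

lemma PA_assoc:
  assumes "f \<in> carrier PA" "g \<in> carrier PA" "h \<in> carrier PA"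
  shows "(f \<otimes>\<^bsub>PA\<^esub> g) \<otimes>\<^bsub>PA\<^esub> h = f \<otimes>\<^bsub>PA\<^esub> (g \<otimes>\<^bsub>PA\<^esub> h)"
  using assms(1)
proof (induction rule: PA_induct)
  case (step c r f')
  have "(path_basis r \<otimes>\<^bsub>PA\<^esub> g) \<otimes>\<^bsub>PA\<^esub> h = path_basis r \<otimes>\<^bsub>PA\<^esub> (g \<otimes>\<^bsub>PA\<^esub> h)"
    using assms(2)
  proof (induction rule: PA_induct)
    case (step d s g')
    have "(path_basis r \<otimes>\<^bsub>PA\<^esub> path_basis s) \<otimes>\<^bsub>PA\<^esub> h = path_basis r \<otimes>\<^bsub>PA\<^esub> (path_basis s \<otimes>\<^bsub>PA\<^esub> h)"
      using assms(3)
      by (induction rule: PA_induct)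
        (simp_all add: PA_zero_mult PA_r_distr PA_smult_r path_basis_assoc \<open>r \<in> paths Q\<close> step.hyps)
    with step show ?case by (simp add: PA_l_distr PA_r_distr PA_smult_l PA_smult_r)
  qed (simp add: PA_zero_mult)
  with step show ?case by (simp add: PA_l_distr PA_smult_l)
qed (simp add: PA_zero_mult)

lemma PA_one_closed: "\<one>\<^bsub>PA\<^esub> \<in> carrier PA"
proof -
  have "{p \<in> paths Q. trivial_path p} \<subseteq> (\<lambda>v. (v, [], v)) ` verts Q" by auto
  from finite_subset[OF this] show ?thesis by (simp add: PA_carrier PA_ops finite_verts)
qed

lemma PA_l_one: assumes "f \<in> carrier PA" shows "\<one>\<^bsub>PA\<^esub> \<otimes>\<^bsub>PA\<^esub> f = f"
proof (rule ext)
  fix p :: "('v, 'e) path"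
  obtain u as w where p: "p = (u, as, w)" by (cases p) auto
  show "(\<one>\<^bsub>PA\<^esub> \<otimes>\<^bsub>PA\<^esub> f) p = f p"
  proof (cases "p \<in> paths Q")
    case True
    \<comment> \<open>\<open>\<one>\<close> is supported on trivial paths, and \<open>p\<close> has
      exactly one decomposition with trivial left factor.\<close>
    have "(\<one>\<^bsub>PA\<^esub> \<otimes>\<^bsub>PA\<^esub> f) p = (\<Sum>(r, s)\<in>{((u, [], u), p)}. \<one>\<^bsub>PA\<^esub> r * f s)"
      unfolding PA_mult
      by (rule sum.mono_neutral_right[OF finite_decomp])
        (use True in \<open>auto simp: p decomp_def PA_ops dest: paths_endpoints split: if_splits\<close>)
    then show ?thesis using True by (auto simp: PA_ops p dest: paths_endpoints)
  qed (use assms in \<open>auto simp: PA_mult decomp_empty PA_carrier\<close>)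
qed

lemma PA_r_one: assumes "f \<in> carrier PA" shows "f \<otimes>\<^bsub>PA\<^esub> \<one>\<^bsub>PA\<^esub> = f"
proof (rule ext)
  fix p :: "('v, 'e) path"
  obtain u as w where p: "p = (u, as, w)" by (cases p) auto
  show "(f \<otimes>\<^bsub>PA\<^esub> \<one>\<^bsub>PA\<^esub>) p = f p"
  proof (cases "p \<in> paths Q")
    case True
    have "(f \<otimes>\<^bsub>PA\<^esub> \<one>\<^bsub>PA\<^esub>) p = (\<Sum>(r, s)\<in>{(p, (w, [], w))}. f r * \<one>\<^bsub>PA\<^esub> s)"
      unfolding PA_mult
      by (rule sum.mono_neutral_right[OF finite_decomp])
        (use True in \<open>auto simp: p decomp_def PA_ops dest: paths_endpoints split: if_splits\<close>)
    then show ?thesis using True by (auto simp: PA_ops p dest: paths_endpoints)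
  qed (use assms in \<open>auto simp: PA_mult decomp_empty PA_carrier\<close>)
qed

lemma PA_k_algebra: "k_algebra (PA :: ('k::field, _) module)"
  unfolding k_algebra_def k_algebra_axioms_def
proof (intro conjI allI impI ringI abelian_groupI monoidI)
  fix x :: "('v, 'e) path \<Rightarrow> 'k" assume x: "x \<in> carrier PA"
  show "\<exists>y\<in>carrier PA. y \<oplus>\<^bsub>PA\<^esub> x = \<zero>\<^bsub>PA\<^esub>"
    by (rule bexI[where x = "(- 1) \<odot>\<^bsub>PA\<^esub> x"], simp add: PA_ops, rule PA_smult_closed[OF x])
next
  show "f \<otimes>\<^bsub>PA\<^esub> g \<otimes>\<^bsub>PA\<^esub> h = f \<otimes>\<^bsub>PA\<^esub> (g \<otimes>\<^bsub>PA\<^esub> h)"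
    if "f \<in> carrier PA" "g \<in> carrier PA" "h \<in> carrier PA" for f g h :: "('v, 'e) path \<Rightarrow> 'k"
    using that by (rule PA_assoc)
qed (simp_all add: PA_l_distr PA_r_distr PA_smult_l PA_smult_r PA_l_one PA_r_one
    PA_add_closed PA_smult_closed PA_zero_closed PA_mult_closed PA_one_closed,
   simp_all add: PA_ops algebra_simps)

lemma idem_closed: "v \<in> verts Q \<Longrightarrow> idem v \<in> carrier PA"
  by (simp add: idem_def path_basis_closed)

lemma arrow_path: "a \<in> arcs Q \<Longrightarrow> (head Q a, [a], tail Q a) \<in> paths Q"
  by simp

lemma arrow_closed: "a \<in> arcs Q \<Longrightarrow> arrow Q a \<in> carrier PA"
  by (simp add: arrow_def path_basis_closed)

lemma PA_finsum_apply:
  assumes "finite I" "\<And>i. i \<in> I \<Longrightarrow> g i \<in> carrier PA"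
  shows "(\<Oplus>\<^bsub>PA\<^esub>i\<in>I. g i) p = (\<Sum>i\<in>I. g i p)"
proof -
  interpret k_algebra PA by (rule PA_k_algebra)
  show ?thesis using assms
    by (induction I rule: finite_induct) (simp_all add: Pi_def PA_ops(1,2))
qed

lemma PA_one_eq: "\<one>\<^bsub>PA\<^esub> = (\<Oplus>\<^bsub>PA\<^esub>v\<in>verts Q. idem v)"
proof (rule ext)
  fix p :: "('v, 'e) path"
  obtain u as w where p: "p = (u, as, w)" by (cases p) auto
  have "(\<Oplus>\<^bsub>PA\<^esub>v\<in>verts Q. idem v) p = (\<Sum>v\<in>verts Q. if v = u then (if p = (u, [], u) then 1 else 0) else 0)"
    by (subst PA_finsum_apply[OF finite_verts idem_closed], assumption, rule sum.cong)
      (auto simp: idem_def path_basis_def p)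
  then show "\<one>\<^bsub>PA\<^esub> p = (\<Oplus>\<^bsub>PA\<^esub>v\<in>verts Q. idem v) p"
    using finite_verts by (auto simp: PA_ops p)
qed

text \<open>Idempotents and arrows generate: a nontrivial path is its first arrow times a shorter
  path, and the paths span.\<close>

lemma PA_hom_eq:
  fixes f g :: "(('v, 'e) path \<Rightarrow> 'k::field) \<Rightarrow> 'b"
  assumes f: "algebra_hom PA B f" and g: "algebra_hom PA B g"
    and idem: "\<And>v. v \<in> verts Q \<Longrightarrow> f (idem v) = g (idem v)"
    and arrow: "\<And>a. a \<in> arcs Q \<Longrightarrow> f (arrow Q a) = g (arrow Q a)"
    and x: "x \<in> carrier PA"
  shows "f x = g x"
proof -
  interpret f: algebra_hom PA B f by (rule f)
  interpret g: algebra_hom PA B g by (rule g)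
  have basis: "(u, as, w) \<in> paths Q \<Longrightarrow> f (path_basis (u, as, w)) = g (path_basis (u, as, w))" for u as w
  proof (induction as arbitrary: u)
    case Nil
    then show ?case using idem[of u] by (auto simp: idem_def)
  next
    case (Cons a as)
    then have a: "a \<in> arcs Q" "(tail Q a, as, w) \<in> paths Q" "u = head Q a" by auto
    have "(path_basis (u, a # as, w) :: _ \<Rightarrow> 'k) = arrow Q a \<otimes>\<^bsub>PA\<^esub> path_basis (tail Q a, as, w)"
      unfolding arrow_def a(3) by (subst path_basis_mult[OF arrow_path[OF a(1)] a(2)]) simp
    then show ?case
      using a Cons.IH[of "tail Q a"] by (simp add: arrow arrow_closed path_basis_closed)
  qed
  show ?thesis using x
  proof (induction rule: PA_induct)
    case (step c p h)
    then show ?case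
      by (cases p) (simp add: PA_smult_closed path_basis_closed f.hom_smult g.hom_smult basis)
  qed simp
qed

end

section \<open>Families of idempotents and arrows as homomorphisms out of a path algebra\<close>

locale quiver_rep = k_algebra R + fin_quiver Q
  for R :: "('k::field, 'a) module" (structure) and Q :: "('v, 'e) pre_digraph"
    and E :: "'v \<Rightarrow> 'a" and A :: "'e \<Rightarrow> 'a" +
  assumes E_closed: "v \<in> verts Q \<Longrightarrow> E v \<in> carrier R"
    and E_orth: "v \<in> verts Q \<Longrightarrow> w \<in> verts Q \<Longrightarrow> E v \<otimes> E w = (if v = w then E v else \<zero>)"
    and E_sum: "(\<Oplus>v\<in>verts Q. E v) = \<one>"
    and A_closed: "a \<in> arcs Q \<Longrightarrow> A a \<in> carrier R"
    and A_head: "a \<in> arcs Q \<Longrightarrow> E (head Q a) \<otimes> A a = A a"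
    and A_tail: "a \<in> arcs Q \<Longrightarrow> A a \<otimes> E (tail Q a) = A a"
begin

text \<open>The recursion ends in the idempotent \<open>E w\<close>, which is the value of a trivial
  path and is absorbed by the last arrow of any other path. The component \<open>u\<close> carries
  no further information on members of \<open>paths Q\<close>.\<close>

fun path_eval :: "('v, 'e) path \<Rightarrow> 'a" where
  "path_eval (u, [], w) = E w"
| "path_eval (u, a # as, w) = A a \<otimes> path_eval (tail Q a, as, w)"

lemma path_eval_props:
  "(u, as, w) \<in> paths Q \<Longrightarrow> path_eval (u, as, w) \<in> carrier R \<and>
    E u \<otimes> path_eval (u, as, w) = path_eval (u, as, w) \<and>
    path_eval (u, as, w) \<otimes> E w = path_eval (u, as, w)"
proof (induction as arbitrary: u)
  case (Cons a as)
  then have a: "a \<in> arcs Q" "(tail Q a, as, w) \<in> paths Q" "u = head Q a" by auto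
  then have v: "u \<in> verts Q" "w \<in> verts Q" using Cons.prems paths_endpoints by blast+
  show ?case using a v Cons.IH[OF a(2)] A_head[OF a(1)] E_closed A_closed
    by (simp add: m_assoc) (simp add: m_assoc[symmetric])
qed (simp add: E_closed E_orth)

lemma path_eval_append:
  "(u, as, w) \<in> paths Q \<Longrightarrow> (w, bs, z) \<in> paths Q \<Longrightarrow>
    path_eval (u, as @ bs, z) = path_eval (u, as, w) \<otimes> path_eval (w, bs, z)"
proof (induction as arbitrary: u)
  case Nil
  then show ?case using path_eval_props[of w bs z] by (cases bs) auto
next
  case (Cons a as)
  then show ?case
    using path_eval_props[of "tail Q a" as w] path_eval_props[of w bs z]
    by (simp add: m_assoc A_closed)
qed

lemma path_eval_closed: "p \<in> paths Q \<Longrightarrow> path_eval p \<in> carrier R"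
  using path_eval_props by (cases p) auto

lemma path_eval_mult:
  assumes "r \<in> paths Q" "s \<in> paths Q"
  shows "path_eval r \<otimes> path_eval s = (if composable r s then path_eval (path_comp r s) else \<zero>)"
proof -
  obtain u as w u' bs z where rs: "r = (u, as, w)" "s = (u', bs, z)" by (cases r; cases s) auto
  have w: "w \<in> verts Q" "u' \<in> verts Q" using assms paths_endpoints by (auto simp: rs)
  show ?thesis
  proof (cases "w = u'")
    case True
    then show ?thesis using assms path_eval_append by (simp add: rs)
  next
    case False
    have r: "path_eval r \<in> carrier R" "path_eval r \<otimes> E w = path_eval r"
      and s: "path_eval s \<in> carrier R" "E u' \<otimes> path_eval s = path_eval s"
      using assms path_eval_props by (auto simp: rs)
    \<comment> \<open>Inserting the idempotents at the two endpoints exposes the orthogonal product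
      \<open>E w \<otimes> E u'\<close>.\<close>
    have "path_eval r \<otimes> path_eval s = (path_eval r \<otimes> E w) \<otimes> (E u' \<otimes> path_eval s)"
      by (simp add: r s)
    also have "\<dots> = path_eval r \<otimes> (E w \<otimes> E u') \<otimes> path_eval s"
      by (simp add: m_assoc r(1) s(1) E_closed w)
    finally show ?thesis using False r(1) s(1) by (simp add: E_orth w rs)
  qed
qed

definition rep_hom :: "(('v, 'e) path \<Rightarrow> 'k) \<Rightarrow> 'a" where
  "rep_hom f = (\<Oplus>p\<in>{p. f p \<noteq> 0}. f p \<odot> path_eval p)"

text \<open>Functions with different supports, such as two summands and their sum, can be compared
  only over a common index set; the additional terms vanish.\<close>

lemma rep_hom_eq:
  assumes "finite S" "{p. f p \<noteq> 0} \<subseteq> S" "S \<subseteq> paths Q"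
  shows "rep_hom f = (\<Oplus>p\<in>S. f p \<odot> path_eval p)"
  unfolding rep_hom_def
proof (rule add.finprod_mono_neutral_cong_left)
  show "f p \<odot> path_eval p = \<zero>" if "p \<in> S - {p. f p \<noteq> 0}" for p
    using subsetD[OF assms(3), of p] that by (simp add: path_eval_closed)
  show "(\<lambda>p. f p \<odot> path_eval p) \<in> S \<rightarrow> carrier R"
    using assms(3) path_eval_closed by auto
qed (use assms in auto)

lemma rep_hom_closed: "f \<in> carrier PA \<Longrightarrow> rep_hom f \<in> carrier R"
  unfolding rep_hom_def by (rule finsum_closed) (auto simp: PA_carrier intro: path_eval_closed)

lemma rep_hom_add:
  assumes "f \<in> carrier PA" "g \<in> carrier PA"
  shows "rep_hom (f \<oplus>\<^bsub>PA\<^esub> g) = rep_hom f \<oplus> rep_hom g"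
proof -
  let ?S = "{p. f p \<noteq> 0} \<union> {p. g p \<noteq> 0}"
  have S: "finite ?S" "?S \<subseteq> paths Q" using assms by (auto simp: PA_carrier)
  have ev: "p \<in> ?S \<Longrightarrow> path_eval p \<in> carrier R" for p using S(2) path_eval_closed by blast
  have "rep_hom (f \<oplus>\<^bsub>PA\<^esub> g) = (\<Oplus>p\<in>?S. (f p + g p) \<odot> path_eval p)"
    by (subst rep_hom_eq[OF S(1) _ S(2)]) (auto simp: PA_ops)
  also have "\<dots> = (\<Oplus>p\<in>?S. f p \<odot> path_eval p \<oplus> g p \<odot> path_eval p)"
    by (rule finsum_cong') (use ev in \<open>auto simp: smult_l_distr\<close>)
  also have "\<dots> = (\<Oplus>p\<in>?S. f p \<odot> path_eval p) \<oplus> (\<Oplus>p\<in>?S. g p \<odot> path_eval p)"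
    by (rule finsum_addf) (use ev in auto)
  also have "\<dots> = rep_hom f \<oplus> rep_hom g"
    by (simp add: rep_hom_eq[OF S(1) _ S(2), of f] rep_hom_eq[OF S(1) _ S(2), of g])
  finally show ?thesis .
qed

lemma rep_hom_path_basis: "p \<in> paths Q \<Longrightarrow> rep_hom (c \<odot>\<^bsub>PA\<^esub> path_basis p) = c \<odot> path_eval p"
  by (subst rep_hom_eq[of "{p}"]) (auto simp: PA_ops path_basis_def path_eval_closed)

lemma rep_hom_zero: "rep_hom \<zero>\<^bsub>PA\<^esub> = \<zero>"
  by (simp add: rep_hom_def PA_ops)

lemma rep_hom_basis: "p \<in> paths Q \<Longrightarrow> rep_hom (path_basis p) = path_eval p"
  using rep_hom_path_basis[of p 1] by (simp add: PA_ops path_eval_closed)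

lemma rep_hom_smult:
  assumes "f \<in> carrier PA" shows "rep_hom (c \<odot>\<^bsub>PA\<^esub> f) = c \<odot> rep_hom f"
  using assms
proof (induction rule: PA_induct)
  case zero
  have "c \<odot>\<^bsub>PA\<^esub> \<zero>\<^bsub>PA\<^esub> = \<zero>\<^bsub>PA\<^esub>" by (simp add: PA_ops)
  then show ?case by (simp add: rep_hom_zero)
next
  case (step d p f)
  have "c \<odot>\<^bsub>PA\<^esub> (d \<odot>\<^bsub>PA\<^esub> path_basis p \<oplus>\<^bsub>PA\<^esub> f) = ((c * d) \<odot>\<^bsub>PA\<^esub> path_basis p) \<oplus>\<^bsub>PA\<^esub> c \<odot>\<^bsub>PA\<^esub> f"
    by (simp add: PA_ops algebra_simps)
  with step show ?case
    by (simp add: rep_hom_add PA_smult_closed path_basis_closed rep_hom_path_basis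
        path_eval_closed rep_hom_closed smult_r_distr smult_smult)
qed

lemma rep_hom_mult:
  assumes "f \<in> carrier PA" "g \<in> carrier PA"
  shows "rep_hom (f \<otimes>\<^bsub>PA\<^esub> g) = rep_hom f \<otimes> rep_hom g"
  using assms(1)
proof (induction rule: PA_induct)
  case zero
  show ?case by (simp add: PA_zero_mult rep_hom_zero rep_hom_closed assms(2))
next
  case (step c r f)
  have "rep_hom (path_basis r \<otimes>\<^bsub>PA\<^esub> g) = path_eval r \<otimes> rep_hom g"
    using assms(2)
  proof (induction rule: PA_induct)
    case zero
    show ?case by (simp add: PA_zero_mult rep_hom_zero path_eval_closed step.hyps)
  next
    case (step d s g)
    have "rep_hom (path_basis r \<otimes>\<^bsub>PA\<^esub> path_basis s) = path_eval r \<otimes> path_eval s"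
      using \<open>r \<in> paths Q\<close> \<open>s \<in> paths Q\<close>
      by (simp add: path_basis_mult path_eval_mult rep_hom_basis path_comp_in_paths rep_hom_zero)
    with step \<open>r \<in> paths Q\<close> show ?case
      by (simp add: PA_r_distr PA_smult_r rep_hom_add rep_hom_smult PA_mult_closed PA_smult_closed
          path_basis_closed rep_hom_basis path_eval_closed rep_hom_closed r_distr smult_mult_r)
  qed
  with step assms(2) show ?case
    by (simp add: PA_l_distr PA_smult_l rep_hom_add rep_hom_smult PA_mult_closed PA_smult_closed
        path_basis_closed rep_hom_basis path_eval_closed rep_hom_closed l_distr smult_mult_l)
qed

lemma rep_hom_idem: "v \<in> verts Q \<Longrightarrow> rep_hom (idem v) = E v"
  by (simp add: idem_def rep_hom_basis)

lemma rep_hom_arrow: "a \<in> arcs Q \<Longrightarrow> rep_hom (arrow Q a) = A a"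
  using rep_hom_basis[OF arrow_path, of a] by (simp add: arrow_def A_tail)

lemma rep_hom_one: "rep_hom \<one>\<^bsub>PA\<^esub> = \<one>"
proof -
  interpret PA: k_algebra "PA :: ('k, _) module" by (rule PA_k_algebra)
  \<comment> \<open>\<open>hom_sum\<close> presupposes that \<open>\<one>\<close> is preserved,
    which is the goal here, so the sum of idempotents is built up one vertex at a time.\<close>
  have "rep_hom (\<Oplus>\<^bsub>PA\<^esub>v\<in>V. idem v) = (\<Oplus>v\<in>V. E v)" if "V \<subseteq> verts Q" for V
    using finite_subset[OF that finite_verts] that
  proof (induction V rule: finite_induct)
    case (insert v V)
    then show ?case
      by (subst PA.finsum_insert finsum_insert; use E_closed idem_closed in \<open>auto simp: Pi_def\<close>)+
        (use insert E_closed idem_closed in \<open>auto simp: rep_hom_add rep_hom_idem subset_iff\<close>)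
  qed (simp add: rep_hom_zero)
  from this[of "verts Q"] show ?thesis by (simp add: PA_one_eq E_sum)
qed

lemma rep_hom_algebra_hom: "algebra_hom PA R rep_hom"
  by (rule algebra_homI)
    (simp_all add: PA_k_algebra k_algebra_axioms rep_hom_closed rep_hom_mult rep_hom_add rep_hom_one
      rep_hom_smult)

end

text \<open>Converse to \<open>rep_hom_algebra_hom\<close>: the identities among idempotents and
  arrows hold in the path algebra and are carried over by \<open>f\<close>.\<close>

lemma (in fin_quiver) quiver_rep_of_hom:
  assumes "algebra_hom PA R f"
  shows "quiver_rep R Q (\<lambda>v. f (idem v)) (\<lambda>a. f (arrow Q a))"
proof -
  interpret f: algebra_hom PA R f by fact
  have idem: "idem v \<otimes>\<^bsub>PA\<^esub> idem w = (if v = w then idem v else \<zero>\<^bsub>PA\<^esub>)"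
    if "v \<in> verts Q" "w \<in> verts Q" for v w
    unfolding idem_def by (subst path_basis_mult) (use that in auto)
  have ar: "idem (head Q a) \<otimes>\<^bsub>PA\<^esub> arrow Q a = arrow Q a" "arrow Q a \<otimes>\<^bsub>PA\<^esub> idem (tail Q a) = arrow Q a"
    if "a \<in> arcs Q" for a
    unfolding idem_def arrow_def by (subst path_basis_mult; use that in auto)+
  show ?thesis
  proof unfold_locales
    show "(\<Oplus>\<^bsub>R\<^esub>v\<in>verts Q. f (idem v)) = \<one>\<^bsub>R\<^esub>"
      using f.hom_sum[of "verts Q" idem] by (simp add: idem_closed PA_one_eq[symmetric])
  qed (auto simp: finite_verts idem_closed arrow_closed idem ar f.hom_mult[symmetric] simp del: f.hom_mult)
qed

subsection \<open>Free algebras and adjoining inverses\<close>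

lemma fin_quiver_loops: "fin_quiver (loops X)"
  by unfold_locales (auto simp: loops_def)

lemma gen_eq_arrow: "gen x = arrow (loops X) x"
  by (simp add: gen_def arrow_def loops_def)

lemma free_algebra_k_algebra: "k_algebra (free_algebra X)"
  unfolding free_algebra_def by (rule fin_quiver.PA_k_algebra[OF fin_quiver_loops])

lemma gen_closed: "x \<in> X \<Longrightarrow> gen x \<in> carrier (free_algebra X)"
  unfolding free_algebra_def gen_eq_arrow[of x X]
  by (rule fin_quiver.arrow_closed[OF fin_quiver_loops]) (simp add: loops_def)

text \<open>If the only idempotent is sent to \<open>\<one>\<close>, the head and tail conditions
  become trivial, so a representation of \<open>loops X\<close> is an arbitrary map on
  \<open>X\<close>.\<close>

lemma free_algebra_lift:
  assumes "k_algebra R" and \<phi>: "\<And>x. x \<in> X \<Longrightarrow> \<phi> x \<in> carrier R"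
  shows "\<exists>f. algebra_hom (free_algebra X) R f \<and> (\<forall>x\<in>X. f (gen x) = \<phi> x)"
proof -
  interpret k_algebra R by fact
  interpret fin_quiver "loops X" by (rule fin_quiver_loops)
  have "quiver_rep R (loops X) (\<lambda>_. \<one>\<^bsub>R\<^esub>) \<phi>"
    by unfold_locales (auto simp: loops_def \<phi>)
  then interpret quiver_rep R "loops X" "\<lambda>_. \<one>\<^bsub>R\<^esub>" \<phi> .
  show ?thesis
  proof (intro exI conjI ballI)
    show "algebra_hom (free_algebra X) R rep_hom"
      unfolding free_algebra_def by (rule rep_hom_algebra_hom)
    show "rep_hom (gen x) = \<phi> x" if "x \<in> X" for x
      using rep_hom_arrow[of x] that by (simp add: gen_eq_arrow[of x X]) (simp add: loops_def)
  qed
qed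

lemma free_algebra_hom_eq:
  fixes f g :: "((unit, 'x) path \<Rightarrow> 'k::field) \<Rightarrow> 'b"
  assumes "algebra_hom (free_algebra X) R f" "algebra_hom (free_algebra X) R g"
    and "\<And>x. x \<in> X \<Longrightarrow> f (gen x) = g (gen x)" "y \<in> carrier (free_algebra X)"
  shows "f y = g y"
proof -
  interpret fin_quiver "loops X" by (rule fin_quiver_loops)
  interpret f: algebra_hom "path_algebra (loops X)" R f
    using assms(1) by (simp add: free_algebra_def)
  interpret g: algebra_hom "path_algebra (loops X)" R g
    using assms(2) by (simp add: free_algebra_def)
  have verts: "verts (loops X) = {()}" and arcs: "arcs (loops X) = X" by (simp_all add: loops_def)
  \<comment> \<open>With a single vertex its idempotent is the unit, on which any two homomorphisms
    agree.\<close>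
  have "(idem () :: _ \<Rightarrow> 'k) \<in> carrier PA" by (rule idem_closed) (simp add: verts)
  then have "(idem () :: _ \<Rightarrow> 'k) = \<one>\<^bsub>PA\<^esub>" unfolding PA_one_eq by (simp add: verts)
  then have idem: "f (idem v) = g (idem v)" for v by simp
  show ?thesis
  proof (rule PA_hom_eq[OF f.algebra_hom_axioms g.algebra_hom_axioms idem])
    show "f (arrow (loops X) a) = g (arrow (loops X) a)" if "a \<in> arcs (loops X)" for a
      using assms(3)[of a] that by (simp add: gen_eq_arrow[of a X] arcs)
    show "y \<in> carrier PA" using assms(4) by (simp add: free_algebra_def)
  qed
qed

section \<open>The universal localization and its universal property\<close>

context
  fixes A :: "('k::field, 'a) module" and S :: "'a set"
  assumes A: "k_algebra A" and S: "S \<subseteq> carrier A"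
begin

interpretation A: k_algebra A by (rule A)

private abbreviation "F \<equiv> free_algebra (carrier A <+> S) :: ('k, ('k, 'a) free_inv) module"

interpretation F: k_algebra F by (rule free_algebra_k_algebra)

lemma gen_Inl_closed: "a \<in> carrier A \<Longrightarrow> gen (Inl a) \<in> carrier F"
  by (rule gen_closed) auto

lemma gen_Inr_closed: "s \<in> S \<Longrightarrow> gen (Inr s) \<in> carrier F"
  by (rule gen_closed) auto

lemma inverses_relationsI:
  "a \<in> carrier A \<Longrightarrow> b \<in> carrier A \<Longrightarrow>
    gen (Inl (a \<oplus>\<^bsub>A\<^esub> b)) \<ominus>\<^bsub>F\<^esub> (gen (Inl a) \<oplus>\<^bsub>F\<^esub> gen (Inl b)) \<in> inverses_relations A S"
  "a \<in> carrier A \<Longrightarrow> b \<in> carrier A \<Longrightarrow>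
    gen (Inl (a \<otimes>\<^bsub>A\<^esub> b)) \<ominus>\<^bsub>F\<^esub> (gen (Inl a) \<otimes>\<^bsub>F\<^esub> gen (Inl b)) \<in> inverses_relations A S"
  "a \<in> carrier A \<Longrightarrow>
    gen (Inl (c \<odot>\<^bsub>A\<^esub> a)) \<ominus>\<^bsub>F\<^esub> (c \<odot>\<^bsub>F\<^esub> gen (Inl a)) \<in> inverses_relations A S"
  "gen (Inl \<one>\<^bsub>A\<^esub>) \<ominus>\<^bsub>F\<^esub> \<one>\<^bsub>F\<^esub> \<in> inverses_relations A S"
  "s \<in> S \<Longrightarrow> (gen (Inl s) \<otimes>\<^bsub>F\<^esub> gen (Inr s)) \<ominus>\<^bsub>F\<^esub> \<one>\<^bsub>F\<^esub> \<in> inverses_relations A S"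
  "s \<in> S \<Longrightarrow> (gen (Inr s) \<otimes>\<^bsub>F\<^esub> gen (Inl s)) \<ominus>\<^bsub>F\<^esub> \<one>\<^bsub>F\<^esub> \<in> inverses_relations A S"
  unfolding inverses_relations_def Let_def by blast+

lemma inverses_relations_closed: "inverses_relations A S \<subseteq> carrier F"
  unfolding inverses_relations_def Let_def
  by (intro Un_least subsetI; elim CollectE exE conjE singletonE; hypsubst;
      intro F.minus_closed F.a_closed F.m_closed F.smult_closed F.one_closed gen_Inl_closed
        gen_Inr_closed A.a_closed A.m_closed A.smult_closed A.one_closed;
      (assumption | rule subsetD[OF S])?; assumption?)

private abbreviation "cls x \<equiv> inverses_ideal A S +>\<^bsub>F\<^esub> x"

lemma inverses_class_hom: "algebra_hom F (adjoin_inverses A S) (\<lambda>x. cls x)"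
  unfolding adjoin_inverses_def inverses_ideal_def
  by (rule quot_algebra_hom[OF F.k_algebra_axioms F.genideal_ideal[OF inverses_relations_closed]])

lemma inverses_class_surj: "carrier (adjoin_inverses A S) = (\<lambda>x. cls x) ` carrier F"
  unfolding adjoin_inverses_def inverses_ideal_def
  by (rule quot_algebra_simps[OF F.k_algebra_axioms F.genideal_ideal[OF inverses_relations_closed]])

lemma inverses_class_eq:
  "x \<in> carrier F \<Longrightarrow> y \<in> carrier F \<Longrightarrow> x \<ominus>\<^bsub>F\<^esub> y \<in> inverses_relations A S \<Longrightarrow> cls x = cls y"
  unfolding inverses_ideal_def
  by (rule quot_genideal_eq[OF F.k_algebra_axioms inverses_relations_closed])

interpretation c: algebra_hom F "adjoin_inverses A S" "\<lambda>x. cls x"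
  by (rule inverses_class_hom)

lemma inverses_map_eq: "inverses_map A S a = cls (gen (Inl a))"
  by (simp add: inverses_map_def)

text \<open>Each of the first four families of relations makes one of the homomorphism laws hold for
  the classes of the generators \<open>Inl a\<close>.\<close>

lemma inverses_map_hom: "algebra_hom A (adjoin_inverses A S) (inverses_map A S)"
proof (rule algebra_homI[OF A c.B.k_algebra_axioms]; unfold inverses_map_eq)
  fix a b c assume a: "a \<in> carrier A"
  show "cls (gen (Inl a)) \<in> carrier (adjoin_inverses A S)" by (simp add: gen_Inl_closed a)
  have "cls (gen (Inl (c \<odot>\<^bsub>A\<^esub> a))) = cls (c \<odot>\<^bsub>F\<^esub> gen (Inl a))"
    by (rule inverses_class_eq[OF _ _ inverses_relationsI(3)]) (simp_all add: a gen_Inl_closed)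
  then show "cls (gen (Inl (c \<odot>\<^bsub>A\<^esub> a))) = c \<odot>\<^bsub>adjoin_inverses A S\<^esub> cls (gen (Inl a))"
    by (simp add: a gen_Inl_closed c.hom_smult)
  assume b: "b \<in> carrier A"
  have "cls (gen (Inl (a \<otimes>\<^bsub>A\<^esub> b))) = cls (gen (Inl a) \<otimes>\<^bsub>F\<^esub> gen (Inl b))"
    by (rule inverses_class_eq[OF _ _ inverses_relationsI(2)]) (simp_all add: a b gen_Inl_closed)
  then show "cls (gen (Inl (a \<otimes>\<^bsub>A\<^esub> b))) = cls (gen (Inl a)) \<otimes>\<^bsub>adjoin_inverses A S\<^esub> cls (gen (Inl b))"
    by (simp add: a b gen_Inl_closed)
  have "cls (gen (Inl (a \<oplus>\<^bsub>A\<^esub> b))) = cls (gen (Inl a) \<oplus>\<^bsub>F\<^esub> gen (Inl b))"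
    by (rule inverses_class_eq[OF _ _ inverses_relationsI(1)]) (simp_all add: a b gen_Inl_closed)
  then show "cls (gen (Inl (a \<oplus>\<^bsub>A\<^esub> b))) = cls (gen (Inl a)) \<oplus>\<^bsub>adjoin_inverses A S\<^esub> cls (gen (Inl b))"
    by (simp add: a b gen_Inl_closed)
next
  have "cls (gen (Inl \<one>\<^bsub>A\<^esub>)) = cls \<one>\<^bsub>F\<^esub>"
    by (rule inverses_class_eq[OF _ _ inverses_relationsI(4)]) (simp_all add: gen_Inl_closed)
  then show "cls (gen (Inl \<one>\<^bsub>A\<^esub>)) = \<one>\<^bsub>adjoin_inverses A S\<^esub>" by simp
qed

lemma inverses_class_inverse:
  assumes s: "s \<in> S"
  shows "inverses_map A S s \<otimes>\<^bsub>adjoin_inverses A S\<^esub> cls (gen (Inr s)) = \<one>\<^bsub>adjoin_inverses A S\<^esub>"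
    and "cls (gen (Inr s)) \<otimes>\<^bsub>adjoin_inverses A S\<^esub> inverses_map A S s = \<one>\<^bsub>adjoin_inverses A S\<^esub>"
proof -
  have sA: "s \<in> carrier A" using s S by auto
  have "cls (gen (Inl s) \<otimes>\<^bsub>F\<^esub> gen (Inr s)) = cls \<one>\<^bsub>F\<^esub>"
    by (rule inverses_class_eq[OF _ _ inverses_relationsI(5)])
      (simp_all add: s sA gen_Inl_closed gen_Inr_closed)
  then show "inverses_map A S s \<otimes>\<^bsub>adjoin_inverses A S\<^esub> cls (gen (Inr s)) = \<one>\<^bsub>adjoin_inverses A S\<^esub>"
    by (simp add: s sA gen_Inl_closed gen_Inr_closed inverses_map_eq)
  have "cls (gen (Inr s) \<otimes>\<^bsub>F\<^esub> gen (Inl s)) = cls \<one>\<^bsub>F\<^esub>"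
    by (rule inverses_class_eq[OF _ _ inverses_relationsI(6)])
      (simp_all add: s sA gen_Inl_closed gen_Inr_closed)
  then show "cls (gen (Inr s)) \<otimes>\<^bsub>adjoin_inverses A S\<^esub> inverses_map A S s = \<one>\<^bsub>adjoin_inverses A S\<^esub>"
    by (simp add: s sA gen_Inl_closed gen_Inr_closed inverses_map_eq)
qed

lemma inverses_map_unit: "s \<in> S \<Longrightarrow> inverses_map A S s \<in> Units (adjoin_inverses A S)"
  using inverses_class_inverse[of s] S
  by (auto simp: Units_def gen_Inl_closed gen_Inr_closed inverses_map_eq
      intro!: bexI[where x = "cls (gen (Inr s))"])

lemma adjoin_inverses_lift:
  assumes "algebra_hom A R \<phi>" and unit: "\<And>s. s \<in> S \<Longrightarrow> \<phi> s \<in> Units R"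
  shows "\<exists>f. algebra_hom (adjoin_inverses A S) R f \<and> (\<forall>a\<in>carrier A. f (inverses_map A S a) = \<phi> a)"
proof -
  interpret \<phi>: algebra_hom A R \<phi> by fact
  \<comment> \<open>The generator \<open>Inr s\<close> can only go to the inverse of
    \<open>\<phi> s\<close>, which \<open>unit\<close> provides.\<close>
  define \<psi> where "\<psi> = case_sum \<phi> (\<lambda>s. inv\<^bsub>R\<^esub> \<phi> s)"
  have "\<psi> x \<in> carrier R" if "x \<in> carrier A <+> S" for x
    using that unit by (auto simp: \<psi>_def)
  from free_algebra_lift[where \<phi> = \<psi>, OF \<phi>.B.k_algebra_axioms this]
  obtain f where f: "algebra_hom F R f"
    and fgen: "\<forall>x\<in>carrier A <+> S. f (gen x) = \<psi> x"
    by blast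
  interpret f: algebra_hom F R f by (rule f)
  have f1: "f (gen (Inl a)) = \<phi> a" if "a \<in> carrier A" for a
    using bspec[OF fgen InlI[OF that]] by (simp add: \<psi>_def)
  have f2: "f (gen (Inr s)) = inv\<^bsub>R\<^esub> \<phi> s" if "s \<in> S" for s
    using bspec[OF fgen InrI[OF that]] by (simp add: \<psi>_def)
  have sA: "s \<in> carrier A" if "s \<in> S" for s using that S by auto
  have "f x = \<zero>\<^bsub>R\<^esub>" if "x \<in> inverses_relations A S" for x
    using that unfolding inverses_relations_def Let_def
    by (elim UnE CollectE exE conjE singletonE; hypsubst;
        simp add: f.hom_minus f.hom_smult gen_Inl_closed gen_Inr_closed f1 f2 sA unit \<phi>.hom_smult)
  from quot_genideal_factor[OF f inverses_relations_closed this]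
  obtain g where "algebra_hom (adjoin_inverses A S) R g" "\<forall>x\<in>carrier F. g (cls x) = f x"
    by (auto simp: adjoin_inverses_def inverses_ideal_def)
  moreover from this(2) have "\<forall>a\<in>carrier A. g (inverses_map A S a) = \<phi> a"
    by (simp add: inverses_map_eq gen_Inl_closed f1)
  ultimately show ?thesis by blast
qed

text \<open>The structure map need not be surjective, but it is an epimorphism: the image of
  \<open>Inr s\<close> is forced, since a left inverse obtained from \<open>f\<close> and a right
  inverse obtained from \<open>g\<close> of the same element coincide.\<close>

lemma adjoin_inverses_hom_eq:
  assumes f: "algebra_hom (adjoin_inverses A S) R f" and g: "algebra_hom (adjoin_inverses A S) R g"
    and eq: "\<And>a. a \<in> carrier A \<Longrightarrow> f (inverses_map A S a) = g (inverses_map A S a)"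
    and x: "x \<in> carrier (adjoin_inverses A S)"
  shows "f x = g x"
proof -
  interpret f: algebra_hom "adjoin_inverses A S" R f by (rule f)
  interpret g: algebra_hom "adjoin_inverses A S" R g by (rule g)
  obtain y where y: "y \<in> carrier F" "x = cls y" using x inverses_class_surj by auto
  have "(f \<circ> (\<lambda>x. cls x)) y = (g \<circ> (\<lambda>x. cls x)) y"
  proof (rule free_algebra_hom_eq[OF algebra_hom_comp[OF inverses_class_hom f]
        algebra_hom_comp[OF inverses_class_hom g] _ y(1)])
    fix z assume "z \<in> carrier A <+> S"
    then consider a where "a \<in> carrier A" "z = Inl a" | s where "s \<in> S" "z = Inr s" by auto
    then show "(f \<circ> (\<lambda>x. cls x)) (gen z) = (g \<circ> (\<lambda>x. cls x)) (gen z)"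
    proof cases
      case 1
      then show ?thesis using eq by (simp add: inverses_map_eq)
    next
      case 2
      then have sA: "s \<in> carrier A" using S by auto
      have cl: "inverses_map A S s \<in> carrier (adjoin_inverses A S)"
        "cls (gen (Inr s)) \<in> carrier (adjoin_inverses A S)"
        using sA 2 by (simp_all add: inverses_map_eq gen_Inl_closed gen_Inr_closed)
      have 1: "f (cls (gen (Inr s))) \<otimes>\<^bsub>R\<^esub> f (inverses_map A S s) = \<one>\<^bsub>R\<^esub>"
        using inverses_class_inverse(2)[OF 2(1)] cl by (simp add: f.hom_mult[symmetric] del: f.hom_mult)
      have 2: "f (inverses_map A S s) \<otimes>\<^bsub>R\<^esub> g (cls (gen (Inr s))) = \<one>\<^bsub>R\<^esub>"
        unfolding eq[OF sA]
        using inverses_class_inverse(1)[OF 2(1)] cl by (simp add: g.hom_mult[symmetric] del: g.hom_mult)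
      have "f (cls (gen (Inr s))) = g (cls (gen (Inr s)))"
        by (rule f.B.inv_unique[OF 1 2]) (simp_all add: cl)
      then show ?thesis using \<open>z = Inr s\<close> by simp
    qed
  qed
  then show ?thesis by (simp add: y)
qed

end

subsection \<open>Representations of the multiplicative preprojective algebra\<close>

definition moment_factor ::
    "('k::field, 'a) module \<Rightarrow> ('e + 'e \<Rightarrow> 'a) \<Rightarrow> 'e + 'e \<Rightarrow> 'a" where
  "moment_factor R A a = \<one>\<^bsub>R\<^esub> \<oplus>\<^bsub>R\<^esub> A a \<otimes>\<^bsub>R\<^esub> A (star a)"

text \<open>The factors are a parameter, because the same product is formed from the localized
  elements \<open>one_plus Q a\<close> and from moment factors. The fold has the shape used in
  \<open>mult_preproj\<close>, so that both unfold to the same term.\<close>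

definition signed_prod ::
    "('k::field, 'a) module \<Rightarrow> ('e + 'e \<Rightarrow> 'a) \<Rightarrow> ('e + 'e) list \<Rightarrow> 'a" where
  "signed_prod R u xs = foldr (\<lambda>x y. x \<otimes>\<^bsub>R\<^esub> y) (map (\<lambda>a. u a [^]\<^bsub>R\<^esub> sgn_arrow a) xs) \<one>\<^bsub>R\<^esub>"

lemma star_star [simp]: "star (star a) = a"
  by (cases a) auto

lemma star_double [simp]:
  "star a \<in> arcs (double Q) \<longleftrightarrow> a \<in> arcs (double Q)"
  "head (double Q) (star a) = tail (double Q) a"
  "tail (double Q) (star a) = head (double Q) a"
  by (cases a; auto simp: double_def)+

lemma (in ring) pow_sgn_arrow:
  "u \<in> Units R \<Longrightarrow> u [^] sgn_arrow a = (if sgn_arrow a = 1 then u else inv u)"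
  by (cases a) (simp_all add: int_pow_def2 Units_closed)

lemma (in ring) pow_sgn_arrow_unit: "u \<in> Units R \<Longrightarrow> u [^] sgn_arrow a \<in> Units R"
  by (simp add: pow_sgn_arrow)

lemma (in algebra_hom) hom_pow_sgn_arrow:
  "u \<in> Units A \<Longrightarrow> f (u [^]\<^bsub>A\<^esub> sgn_arrow a) = f u [^]\<^bsub>B\<^esub> sgn_arrow a"
  by (simp add: A.pow_sgn_arrow B.pow_sgn_arrow hom_unit hom_inv)

lemma (in algebra_hom) hom_signed_prod:
  assumes "\<And>a. a \<in> set xs \<Longrightarrow> u a \<in> Units A"
  shows "f (signed_prod A u xs) = signed_prod B (\<lambda>a. f (u a)) xs"
  unfolding signed_prod_def
  by (subst hom_foldr_mult)
    (use assms in \<open>auto simp: hom_pow_sgn_arrow A.pow_sgn_arrow_unit A.Units_closed o_def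
      intro!: arg_cong2[of _ _ _ _ "foldr _"]\<close>)

lemma (in k_algebra) signed_prod_closed:
  "(\<And>a. a \<in> set xs \<Longrightarrow> u a \<in> Units R) \<Longrightarrow> signed_prod R u xs \<in> carrier R"
  unfolding signed_prod_def
  by (induction xs) (auto simp: pow_sgn_arrow_unit Units_closed)

lemma signed_prod_cong:
  "(\<And>a. a \<in> set xs \<Longrightarrow> u a = w a) \<Longrightarrow> signed_prod R u xs = signed_prod R w xs"
  unfolding signed_prod_def by (auto intro!: arg_cong2[of _ _ _ _ "foldr _"])

text \<open>A solution of the defining relation in \<open>R\<close>. A bare list stands for the
  ordering, so that every intermediate stage of a reordering is again an instance.\<close>

locale mpp_rep = quiver_rep R "double Q" E A
  for R :: "('k::field, 'a) module" (structure) and Q :: "('v, 'e) pre_digraph"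
    and E :: "'v \<Rightarrow> 'a" and A :: "'e + 'e \<Rightarrow> 'a" +
  fixes q :: "'v \<Rightarrow> 'k" and xs :: "('e + 'e) list"
  assumes factor_unit: "a \<in> arcs (double Q) \<Longrightarrow> moment_factor R A a \<in> Units R"
    and relation: "signed_prod R (moment_factor R A) xs = (\<Oplus>v\<in>verts Q. q v \<odot> E v)"

text \<open>
  The test algebras range over a single carrier type, since a HOL definition cannot quantify over
  types; comparing two universal algebras only requires test algebras of their common type.
\<close>

definition mpp_universal ::
    "('v, 'e) pre_digraph \<Rightarrow> ('v \<Rightarrow> 'k::field) \<Rightarrow> ('e + 'e) list \<Rightarrow> ('k, 'a) module \<Rightarrow>
      ('v \<Rightarrow> 'a) \<Rightarrow> ('e + 'e \<Rightarrow> 'a) \<Rightarrow> bool" where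
  "mpp_universal Q q xs R E A \<longleftrightarrow> mpp_rep R Q E A q xs \<and>
    (\<forall>(S :: ('k, 'a) module) E' A'. mpp_rep S Q E' A' q xs \<longrightarrow>
      (\<exists>f. algebra_hom R S f \<and> (\<forall>v\<in>verts Q. f (E v) = E' v) \<and>
        (\<forall>a\<in>arcs (double Q). f (A a) = A' a))) \<and>
    (\<forall>(S :: ('k, 'a) module) f g. algebra_hom R S f \<longrightarrow> algebra_hom R S g \<longrightarrow>
      (\<forall>v\<in>verts Q. f (E v) = g (E v)) \<longrightarrow> (\<forall>a\<in>arcs (double Q). f (A a) = g (A a)) \<longrightarrow>
      (\<forall>x\<in>carrier R. f x = g x))"

lemma mpp_universal_rep: "mpp_universal Q q xs R E A \<Longrightarrow> mpp_rep R Q E A q xs"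
  by (simp add: mpp_universal_def)

lemma mpp_universal_lift:
  fixes R S :: "('k::field, 'a) module"
  assumes "mpp_universal Q q xs R E A" "mpp_rep S Q E' A' q xs"
  obtains f where "algebra_hom R S f" "\<And>v. v \<in> verts Q \<Longrightarrow> f (E v) = E' v"
    "\<And>a. a \<in> arcs (double Q) \<Longrightarrow> f (A a) = A' a"
proof -
  from assms have "\<exists>f. algebra_hom R S f \<and> (\<forall>v\<in>verts Q. f (E v) = E' v) \<and>
        (\<forall>a\<in>arcs (double Q). f (A a) = A' a)"
    unfolding mpp_universal_def by blast
  with that show ?thesis by blast
qed

lemma mpp_universal_eq:
  fixes R S :: "('k::field, 'a) module"
  assumes "mpp_universal Q q xs R E A" "algebra_hom R S f" "algebra_hom R S g"
    and "\<And>v. v \<in> verts Q \<Longrightarrow> f (E v) = g (E v)"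
    and "\<And>a. a \<in> arcs (double Q) \<Longrightarrow> f (A a) = g (A a)" and "x \<in> carrier R"
  shows "f x = g x"
proof -
  have "\<forall>x\<in>carrier R. f x = g x"
    using assms(1)[unfolded mpp_universal_def, THEN conjunct2, THEN conjunct2] assms(2-5) by simp
  with assms(6) show ?thesis by blast
qed

lemma fin_quiver_double: "fin_digraph Q \<Longrightarrow> fin_quiver (double Q)"
proof -
  assume "fin_digraph Q"
  then interpret fin_digraph Q .
  show ?thesis by unfold_locales (auto simp: double_def)
qed

text \<open>Three universal properties are stacked: path algebra, localization, quotient by the
  relation. Existence of homomorphisms climbs through these layers and uniqueness descends through
  them.\<close>

lemma mult_preproj_universal:
  fixes Q :: "('v, 'e) pre_digraph" and q :: "'v \<Rightarrow> 'k::field"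
  assumes Q: "fin_digraph Q" and xs: "xs = increasing_list (arcs (double Q)) r"
    and set_xs: "set xs \<subseteq> arcs (double Q)"
  shows "\<exists>E A. mpp_universal Q q xs (mult_preproj Q r q) E A"
proof -
  interpret fin_quiver "double Q" by (rule fin_quiver_double[OF Q])
  let ?P = "PA :: ('k, ('v, 'e + 'e) path \<Rightarrow> 'k) module"
  interpret P: k_algebra ?P by (rule PA_k_algebra)
  define S where "S = (one_plus Q ` arcs (double Q) :: (('v, 'e + 'e) path \<Rightarrow> 'k) set)"
  have verts: "verts (double Q) = verts Q" by (simp add: double_def)
  have op: "one_plus Q a = moment_factor ?P (arrow (double Q)) a" for a
    by (simp add: one_plus_def moment_factor_def Let_def)
  have S: "S \<subseteq> carrier ?P"
    by (auto simp: S_def op moment_factor_def arrow_closed)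
  define L where "L = adjoin_inverses ?P S"
  define i where "i = inverses_map ?P S"
  have i: "algebra_hom ?P L i" unfolding L_def i_def by (rule inverses_map_hom[OF P.k_algebra_axioms S])
  interpret i: algebra_hom ?P L i by (rule i)
  have iop: "i (one_plus Q a) = moment_factor L (\<lambda>a. i (arrow (double Q) a)) a"
    if "a \<in> arcs (double Q)" for a
    using that by (simp add: op moment_factor_def arrow_closed)
  have iu: "i (one_plus Q a) \<in> Units L" if "a \<in> arcs (double Q)" for a
    unfolding L_def i_def using that by (intro inverses_map_unit[OF P.k_algebra_axioms S]) (simp add: S_def)
  define lhs where "lhs = signed_prod L (\<lambda>a. i (one_plus Q a)) xs"
  define rhs where "rhs = i (\<Oplus>\<^bsub>?P\<^esub>v\<in>verts Q. q v \<odot>\<^bsub>?P\<^esub> idem v)"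
  have lhs: "lhs \<in> carrier L"
    unfolding lhs_def by (rule i.B.signed_prod_closed) (use iu set_xs in auto)
  have idem: "v \<in> verts Q \<Longrightarrow> idem v \<in> carrier ?P" for v by (rule idem_closed) (simp add: verts)
  have rhs: "rhs \<in> carrier L"
    unfolding rhs_def by (intro i.hom_closed P.finsum_closed) (use idem in auto)
  let ?T = "{lhs \<ominus>\<^bsub>L\<^esub> rhs}"
  define M where "M = quot_algebra L (genideal L ?T)"
  have M: "mult_preproj Q r q = M"
    by (simp add: mult_preproj_def Let_def M_def lhs_def rhs_def L_def i_def S_def signed_prod_def xs)
  define p where "p y = genideal L ?T +>\<^bsub>L\<^esub> y" for y
  have T: "?T \<subseteq> carrier L" using lhs rhs by simp
  have p: "algebra_hom L M p"
    unfolding M_def p_def by (rule quot_algebra_hom[OF i.B.k_algebra_axioms i.B.genideal_ideal[OF T]])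
  interpret p: algebra_hom L M p by (rule p)
  have p_surj: "carrier M = p ` carrier L"
    unfolding M_def p_def
    by (rule quot_algebra_simps[OF i.B.k_algebra_axioms i.B.genideal_ideal[OF T]])
  have p_rel: "p lhs = p rhs"
    unfolding p_def by (rule quot_genideal_eq[OF i.B.k_algebra_axioms T lhs rhs]) simp
  let ?E = "\<lambda>v. p (i (idem v))" and ?A = "\<lambda>a. p (i (arrow (double Q) a))"
  have pmf: "p (i (one_plus Q a)) = moment_factor M ?A a" if "a \<in> arcs (double Q)" for a
    using that by (simp add: op moment_factor_def arrow_closed)
  have rep: "mpp_rep M Q ?E ?A q xs"
  proof (intro mpp_rep.intro mpp_rep_axioms.intro)
    show "quiver_rep M (double Q) ?E ?A"
      using quiver_rep_of_hom[OF algebra_hom_comp[OF i p]] by simp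
    show "moment_factor M ?A a \<in> Units M" if "a \<in> arcs (double Q)" for a
      unfolding pmf[OF that, symmetric] by (rule p.hom_unit[OF iu[OF that]])
    have "signed_prod M (moment_factor M ?A) xs = signed_prod M (\<lambda>a. p (i (one_plus Q a))) xs"
      by (rule signed_prod_cong) (use set_xs pmf in auto)
    also have "\<dots> = p lhs"
      unfolding lhs_def by (rule p.hom_signed_prod[symmetric]) (use set_xs iu in auto)
    also have "\<dots> = p rhs" by (rule p_rel)
    also have "\<dots> = (\<Oplus>\<^bsub>M\<^esub>v\<in>verts Q. p (i (q v \<odot>\<^bsub>?P\<^esub> idem v)))"
      unfolding rhs_def by (subst i.hom_sum, simp add: idem, subst p.hom_sum) (simp_all add: idem)
    also have "\<dots> = (\<Oplus>\<^bsub>M\<^esub>v\<in>verts Q. q v \<odot>\<^bsub>M\<^esub> ?E v)"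
      by (rule p.B.finsum_cong') (auto simp: idem i.hom_smult p.hom_smult)
    finally show "signed_prod M (moment_factor M ?A) xs = (\<Oplus>\<^bsub>M\<^esub>v\<in>verts Q. q v \<odot>\<^bsub>M\<^esub> ?E v)" .
  qed
  have lift: "\<exists>f. algebra_hom M R f \<and> (\<forall>v\<in>verts Q. f (?E v) = E' v) \<and>
        (\<forall>a\<in>arcs (double Q). f (?A a) = A' a)"
    if "mpp_rep R Q E' A' q xs" for R :: "('k, ('k, ('v, 'e + 'e) path \<Rightarrow> 'k) free_inv set set) module" and E' A'
  proof -
    interpret R: mpp_rep R Q E' A' q xs by (rule that)
    let ?h = "R.rep_hom"
    interpret h: algebra_hom ?P R ?h by (rule R.rep_hom_algebra_hom)
    have hop: "?h (one_plus Q a) = moment_factor R A' a" if "a \<in> arcs (double Q)" for a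
      using that by (simp add: op moment_factor_def arrow_closed R.rep_hom_arrow)
    have "?h s \<in> Units R" if "s \<in> S" for s
      using that by (auto simp: S_def hop R.factor_unit)
    from adjoin_inverses_lift[OF P.k_algebra_axioms S R.rep_hom_algebra_hom this]
    obtain g where g: "algebra_hom L R g" and gi: "\<forall>a\<in>carrier ?P. g (i a) = ?h a"
      unfolding L_def i_def by blast
    interpret g: algebra_hom L R g by (rule g)
    have gop: "g (i (one_plus Q a)) = moment_factor R A' a" if "a \<in> arcs (double Q)" for a
    proof -
      have "one_plus Q a \<in> carrier ?P" using S that by (auto simp: S_def)
      then show ?thesis using gi that by (simp add: hop)
    qed
    have "g lhs = signed_prod R (\<lambda>a. g (i (one_plus Q a))) xs"
      unfolding lhs_def by (rule g.hom_signed_prod) (use set_xs iu in auto)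
    also have "\<dots> = signed_prod R (moment_factor R A') xs"
      by (rule signed_prod_cong) (use set_xs gop in auto)
    also have "\<dots> = (\<Oplus>\<^bsub>R\<^esub>v\<in>verts Q. q v \<odot>\<^bsub>R\<^esub> E' v)" by (rule R.relation)
    also have "\<dots> = (\<Oplus>\<^bsub>R\<^esub>v\<in>verts Q. ?h (q v \<odot>\<^bsub>?P\<^esub> idem v))"
      by (rule R.finsum_cong') (auto simp: idem h.hom_smult R.rep_hom_idem verts R.E_closed)
    also have "\<dots> = ?h (\<Oplus>\<^bsub>?P\<^esub>v\<in>verts Q. q v \<odot>\<^bsub>?P\<^esub> idem v)"
      by (rule h.hom_sum[symmetric]) (simp add: idem)
    also have "\<dots> = g rhs"
      unfolding rhs_def by (rule bspec[OF gi, symmetric]) (auto simp: idem)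
    finally have "g lhs = g rhs" .
    then have "g x = \<zero>\<^bsub>R\<^esub>" if "x \<in> ?T" for x
      using that lhs rhs by (simp add: g.hom_minus)
    from quot_genideal_factor[OF g T this]
    obtain f where f: "algebra_hom M R f" and fp: "\<forall>x\<in>carrier L. f (p x) = g x"
      unfolding M_def p_def by blast
    show ?thesis
      by (rule exI[of _ f])
        (use f fp gi in \<open>simp add: idem arrow_closed R.rep_hom_idem R.rep_hom_arrow verts\<close>)
  qed
  have eq: "f x = g x"
    if f: "algebra_hom M R f" and g: "algebra_hom M R g"
      and E: "\<forall>v\<in>verts Q. f (?E v) = g (?E v)" and A: "\<forall>a\<in>arcs (double Q). f (?A a) = g (?A a)"
      and x: "x \<in> carrier M"
    for R :: "('k, ('k, ('v, 'e + 'e) path \<Rightarrow> 'k) free_inv set set) module" and f g x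
  proof -
    \<comment> \<open>Agreement is pulled back along the surjection \<open>p\<close>, then tested on
      the image of \<open>i\<close>, which suffices for a localization, and finally on the
      generators of the path algebra.\<close>
    obtain y where y: "y \<in> carrier L" "x = p y" using x p_surj by auto
    have fp: "algebra_hom L R (f \<circ> p)" and gp: "algebra_hom L R (g \<circ> p)"
      by (rule algebra_hom_comp[OF p f], rule algebra_hom_comp[OF p g])
    have "((f \<circ> p) \<circ> i) z = ((g \<circ> p) \<circ> i) z" if z: "z \<in> carrier ?P" for z
    proof (rule PA_hom_eq[OF algebra_hom_comp[OF i fp] algebra_hom_comp[OF i gp] _ _ z])
      show "((f \<circ> p) \<circ> i) (idem v) = ((g \<circ> p) \<circ> i) (idem v)" if "v \<in> verts (double Q)" for v
        using E that by (simp add: verts)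
      show "((f \<circ> p) \<circ> i) (arrow (double Q) a) = ((g \<circ> p) \<circ> i) (arrow (double Q) a)"
        if "a \<in> arcs (double Q)" for a
        using A that by simp
    qed
    then have "(f \<circ> p) (i z) = (g \<circ> p) (i z)" if "z \<in> carrier ?P" for z
      using that by simp
    with adjoin_inverses_hom_eq[OF P.k_algebra_axioms S fp[unfolded L_def] gp[unfolded L_def]] y(1)
    have "(f \<circ> p) y = (g \<circ> p) y"
      unfolding L_def i_def by blast
    then show ?thesis by (simp add: y)
  qed
  have "mpp_universal Q q xs M ?E ?A"
    unfolding mpp_universal_def
  proof (intro conjI allI impI)
    fix R :: "('k, ('k, ('v, 'e + 'e) path \<Rightarrow> 'k) free_inv set set) module" and f g
    show "\<forall>x\<in>carrier M. f x = g x"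
      if "algebra_hom M R f" "algebra_hom M R g" "\<forall>v\<in>verts Q. f (?E v) = g (?E v)"
        "\<forall>a\<in>arcs (double Q). f (?A a) = g (?A a)"
    proof
      fix x assume "x \<in> carrier M"
      then show "f x = g x" by (rule eq[OF that])
    qed
  qed (rule rep lift; assumption?)+
  then show ?thesis unfolding M by blast
qed

text \<open>The usual uniqueness of a universal object. It applies to \<open>Q\<close> and its
  reversal because \<open>reverse_arrows\<close> keeps the types of vertices and arrows, so both
  algebras live on one carrier type.\<close>

lemma mpp_universal_iso:
  fixes R S :: "('k::field, 'a) module"
  assumes R: "mpp_universal Q q xs R E A" and S: "mpp_universal Q q xs S E' A'"
  shows "alg_iso R S"
proof -
  obtain f where f: "algebra_hom R S f" and fE: "\<And>v. v \<in> verts Q \<Longrightarrow> f (E v) = E' v"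
    and fA: "\<And>a. a \<in> arcs (double Q) \<Longrightarrow> f (A a) = A' a"
    using R mpp_universal_rep[OF S] by (rule mpp_universal_lift) blast
  obtain g where g: "algebra_hom S R g" and gE: "\<And>v. v \<in> verts Q \<Longrightarrow> g (E' v) = E v"
    and gA: "\<And>a. a \<in> arcs (double Q) \<Longrightarrow> g (A' a) = A a"
    using S mpp_universal_rep[OF R] by (rule mpp_universal_lift) blast
  interpret f: algebra_hom R S f by (rule f)
  interpret g: algebra_hom S R g by (rule g)
  have gf: "g (f x) = x" if "x \<in> carrier R" for x
    using mpp_universal_eq[OF R algebra_hom_comp[OF f g] algebra_hom_id[OF f.A.k_algebra_axioms] _ _ that]
    by (simp add: fE fA gE gA)
  have fg: "f (g x) = x" if "x \<in> carrier S" for x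
    using mpp_universal_eq[OF S algebra_hom_comp[OF g f] algebra_hom_id[OF f.B.k_algebra_axioms] _ _ that]
    by (simp add: fE fA gE gA)
  have "bij_betw f (carrier R) (carrier S)"
    by (rule bij_betw_byWitness[where f' = g]) (auto simp: gf fg)
  then have "f \<in> ring_iso R S" by (simp add: ring_iso_def f.hom_ring)
  then show ?thesis unfolding alg_iso_def using f.hom_smult by blast
qed

subsection \<open>Changing the generators of a universal algebra\<close>

text \<open>Here \<open>lift\<close> turns a solution for the new data into one for the old data in
  such a way that homomorphisms matching the old arrows also match the new ones. The premise
  \<open>eq\<close> expresses that \<open>B\<close> determines \<open>A\<close>, which gives
  uniqueness.\<close>

lemma mpp_universal_transfer:
  fixes R :: "('k::field, 'a) module"
  assumes U: "mpp_universal Q q xs R E A"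
    and rep: "mpp_rep R Q' E B q ys" and verts: "verts Q' = verts Q"
    and lift: "\<And>(S :: ('k, 'a) module) E' B'. mpp_rep S Q' E' B' q ys \<Longrightarrow>
      \<exists>A'. mpp_rep S Q E' A' q xs \<and>
        (\<forall>f. algebra_hom R S f \<longrightarrow> (\<forall>a\<in>arcs (double Q). f (A a) = A' a) \<longrightarrow>
          (\<forall>a\<in>arcs (double Q'). f (B a) = B' a))"
    and eq: "\<And>(S :: ('k, 'a) module) f g a. algebra_hom R S f \<Longrightarrow> algebra_hom R S g \<Longrightarrow>
      (\<And>a. a \<in> arcs (double Q') \<Longrightarrow> f (B a) = g (B a)) \<Longrightarrow> a \<in> arcs (double Q) \<Longrightarrow> f (A a) = g (A a)"
  shows "mpp_universal Q' q ys R E B"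
  unfolding mpp_universal_def
proof (intro conjI allI impI)
  fix S :: "('k, 'a) module" and E' B' assume "mpp_rep S Q' E' B' q ys"
  from lift[OF this] obtain A' where A': "mpp_rep S Q E' A' q xs"
    and fB: "\<And>f. algebra_hom R S f \<Longrightarrow> \<forall>a\<in>arcs (double Q). f (A a) = A' a \<Longrightarrow>
        \<forall>a\<in>arcs (double Q'). f (B a) = B' a"
    by blast
  obtain f where f: "algebra_hom R S f" "\<And>v. v \<in> verts Q \<Longrightarrow> f (E v) = E' v"
    "\<And>a. a \<in> arcs (double Q) \<Longrightarrow> f (A a) = A' a"
    using U A' by (rule mpp_universal_lift) blast
  then show "\<exists>f. algebra_hom R S f \<and> (\<forall>v\<in>verts Q'. f (E v) = E' v) \<and>
      (\<forall>a\<in>arcs (double Q'). f (B a) = B' a)"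
    using fB[OF f(1)] by (auto simp: verts)
next
  fix S :: "('k, 'a) module" and f g
  assume f: "algebra_hom R S f" and g: "algebra_hom R S g"
    and E: "\<forall>v\<in>verts Q'. f (E v) = g (E v)" and B: "\<forall>a\<in>arcs (double Q'). f (B a) = g (B a)"
  show "\<forall>x\<in>carrier R. f x = g x"
  proof
    fix x assume x: "x \<in> carrier R"
    show "f x = g x"
    proof (rule mpp_universal_eq[OF U f g _ _ x])
      show "f (E v) = g (E v)" if "v \<in> verts Q" for v using E that verts by simp
      show "f (A a) = g (A a)" if "a \<in> arcs (double Q)" for a
        by (rule eq[OF f g _ that]) (use B in simp)
    qed
  qed
qed (rule rep)

section \<open>Commutation with the idempotents and cyclic rotation of the relation\<close>

lemma (in monoid) inv_commute:
  assumes "u \<in> Units G" "x \<in> carrier G" "x \<otimes> u = u \<otimes> x"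
  shows "x \<otimes> inv u = inv u \<otimes> x"
proof -
  have "inv u \<otimes> (x \<otimes> u) \<otimes> inv u = inv u \<otimes> (u \<otimes> x) \<otimes> inv u" by (simp only: assms(3))
  moreover have "inv u \<otimes> (x \<otimes> u) \<otimes> inv u = inv u \<otimes> x"
    using assms(1,2) by (simp add: m_assoc Units_closed)
  moreover have "inv u \<otimes> (u \<otimes> x) \<otimes> inv u = x \<otimes> inv u"
    using assms(1,2) by (simp add: m_assoc[symmetric] Units_closed)
  ultimately show ?thesis by simp
qed

text \<open>This is the computation behind reversal. With \<open>w\<close> and \<open>z\<close> the
  inverses of \<open>\<one> \<oplus> x \<otimes> y\<close> and
  \<open>\<one> \<oplus> y \<otimes> x\<close>, the first identity is
  \<open>w \<oplus> w \<otimes> x \<otimes> y = \<one>\<close> solved for \<open>w\<close>. The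
  second is the analogous equation for \<open>z\<close>, rewritten with
  \<open>z \<otimes> y = y \<otimes> w\<close>; this comes from moving \<open>y\<close> across:
  \<open>y \<otimes> (\<one> \<oplus> x \<otimes> y) = (\<one> \<oplus> y \<otimes> x) \<otimes>
  y\<close>.\<close>

lemma (in ring) inv_one_plus_swap:
  assumes x: "x \<in> carrier R" and y: "y \<in> carrier R"
    and u: "\<one> \<oplus> x \<otimes> y \<in> Units R" and v: "\<one> \<oplus> y \<otimes> x \<in> Units R"
  shows "inv (\<one> \<oplus> x \<otimes> y) = \<one> \<oplus> \<ominus> (inv (\<one> \<oplus> x \<otimes> y) \<otimes> x) \<otimes> y"
    and "inv (\<one> \<oplus> y \<otimes> x) = \<one> \<oplus> y \<otimes> \<ominus> (inv (\<one> \<oplus> x \<otimes> y) \<otimes> x)"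
proof -
  define w z where "w = inv (\<one> \<oplus> x \<otimes> y)" and "z = inv (\<one> \<oplus> y \<otimes> x)"
  have w: "w \<in> carrier R" "w \<otimes> (\<one> \<oplus> x \<otimes> y) = \<one>" "(\<one> \<oplus> x \<otimes> y) \<otimes> w = \<one>"
    using u by (auto simp: w_def)
  have z: "z \<in> carrier R" "z \<otimes> (\<one> \<oplus> y \<otimes> x) = \<one>"
    using v by (auto simp: z_def)
  have w': "w \<oplus> w \<otimes> x \<otimes> y = \<one>"
    using w x y by (simp add: r_distr m_assoc)
  have "\<one> \<oplus> \<ominus> (w \<otimes> x) \<otimes> y = (w \<oplus> w \<otimes> x \<otimes> y) \<oplus> \<ominus> (w \<otimes> x) \<otimes> y"
    by (simp only: w')
  also have "\<dots> = w" using w(1) x y by (simp add: l_minus a_assoc r_neg)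
  finally show "inv (\<one> \<oplus> x \<otimes> y) = \<one> \<oplus> \<ominus> (inv (\<one> \<oplus> x \<otimes> y) \<otimes> x) \<otimes> y"
    by (simp add: w_def)
  have "z \<otimes> y = z \<otimes> (y \<otimes> ((\<one> \<oplus> x \<otimes> y) \<otimes> w))" using w(3) y z(1) by simp
  also have "\<dots> = z \<otimes> (y \<otimes> (\<one> \<oplus> x \<otimes> y)) \<otimes> w" using w(1) x y z(1) by (simp add: m_assoc)
  also have "y \<otimes> (\<one> \<oplus> x \<otimes> y) = (\<one> \<oplus> y \<otimes> x) \<otimes> y" using x y by (simp add: l_distr r_distr m_assoc)
  also have "z \<otimes> ((\<one> \<oplus> y \<otimes> x) \<otimes> y) \<otimes> w = y \<otimes> w"
    using z x y w(1) by (simp add: m_assoc[symmetric])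
  finally have zy: "z \<otimes> y = y \<otimes> w" .
  have z': "z \<oplus> z \<otimes> y \<otimes> x = \<one>" using z x y by (simp add: r_distr m_assoc)
  have "\<one> \<oplus> y \<otimes> \<ominus> (w \<otimes> x) = (z \<oplus> z \<otimes> y \<otimes> x) \<oplus> y \<otimes> \<ominus> (w \<otimes> x)" by (simp only: z')
  also have "\<dots> = z"
    using z(1) w(1) x y by (simp add: zy r_minus a_assoc r_neg m_assoc)
  finally show "inv (\<one> \<oplus> y \<otimes> x) = \<one> \<oplus> y \<otimes> \<ominus> (inv (\<one> \<oplus> x \<otimes> y) \<otimes> x)"
    by (simp add: w_def z_def)
qed

lemma signed_prod_simps:
  "signed_prod R u [] = \<one>\<^bsub>R\<^esub>"
  "signed_prod R u (a # xs) = u a [^]\<^bsub>R\<^esub> sgn_arrow a \<otimes>\<^bsub>R\<^esub> signed_prod R u xs"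
  by (simp_all add: signed_prod_def)

lemma (in k_algebra) signed_prod_append:
  "(\<And>a. a \<in> set (xs @ ys) \<Longrightarrow> u a \<in> Units R) \<Longrightarrow>
    signed_prod R u (xs @ ys) = signed_prod R u xs \<otimes> signed_prod R u ys"
proof (induction xs)
  case (Cons a xs)
  then show ?case
    by (simp add: signed_prod_simps m_assoc Units_closed pow_sgn_arrow_unit signed_prod_closed)
qed (simp add: signed_prod_simps signed_prod_closed)

context mpp_rep
begin

lemma verts_double: "verts (double Q) = verts Q"
  by (simp add: double_def)

text \<open>Units that are block diagonal for the idempotents. Multiplying an arrow by such a unit
  keeps its endpoints, and such a unit commutes with the right side of the relation; it need not be
  central in \<open>R\<close>.\<close>

definition E_central :: "'a \<Rightarrow> bool" where
  "E_central c \<longleftrightarrow> c \<in> Units R \<and> (\<forall>v\<in>verts Q. E v \<otimes> c = c \<otimes> E v)"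

lemma E_central_inv: "E_central c \<Longrightarrow> E_central (inv c)"
  using E_closed by (auto simp: E_central_def verts_double intro: inv_commute)

lemma E_central_mult:
  assumes "E_central c" "E_central d" shows "E_central (c \<otimes> d)"
proof -
  have cd: "c \<in> carrier R" "d \<in> carrier R" using assms by (auto simp: E_central_def)
  have "E v \<otimes> (c \<otimes> d) = (c \<otimes> d) \<otimes> E v" if v: "v \<in> verts Q" for v
  proof -
    have Ev: "E v \<in> carrier R" using E_closed v by (simp add: verts_double)
    have "E v \<otimes> (c \<otimes> d) = (E v \<otimes> c) \<otimes> d" using Ev cd by (simp add: m_assoc)
    also have "\<dots> = c \<otimes> (E v \<otimes> d)" using assms(1) v Ev cd by (simp add: E_central_def m_assoc)
    also have "\<dots> = (c \<otimes> d) \<otimes> E v" using assms(2) v Ev cd by (simp add: E_central_def m_assoc)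
    finally show ?thesis .
  qed
  then show ?thesis using assms by (simp add: E_central_def)
qed

text \<open>The product of \<open>A a\<close> and \<open>A (star a)\<close> is a cycle at the head
  \<open>h\<close> of \<open>a\<close>: from either side it is fixed by \<open>E h\<close> and
  killed by every other idempotent.\<close>

lemma E_central_factor:
  assumes a: "a \<in> arcs (double Q)" shows "E_central (moment_factor R A a)"
proof -
  have sa: "star a \<in> arcs (double Q)" using a by simp
  define x y where "x = A a" and "y = A (star a)"
  have xy: "x \<in> carrier R" "y \<in> carrier R" using a sa by (auto simp: x_def y_def A_closed)
  define h where "h = head (double Q) a"
  have h: "h \<in> verts Q" using head_in_verts[OF a] by (simp add: h_def verts_double)
  have Eh: "E h \<in> carrier R" using h E_closed by (simp add: verts_double)
  have hx: "E h \<otimes> x = x" and yh: "y \<otimes> E h = y"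
    using A_head[OF a] A_tail[OF sa] by (auto simp: x_def y_def h_def)
  have "E v \<otimes> moment_factor R A a = moment_factor R A a \<otimes> E v" if v: "v \<in> verts Q" for v
  proof -
    have Ev: "E v \<in> carrier R" using v E_closed by (simp add: verts_double)
    have "E v \<otimes> (x \<otimes> y) = (E v \<otimes> E h) \<otimes> (x \<otimes> y)"
      using xy Ev Eh by (simp add: m_assoc[symmetric]) (simp add: m_assoc hx)
    moreover have "(x \<otimes> y) \<otimes> E v = (x \<otimes> y) \<otimes> (E h \<otimes> E v)"
      using xy Ev Eh by (simp add: m_assoc) (simp add: m_assoc[symmetric] yh)
    moreover have "E h \<otimes> (x \<otimes> y) = x \<otimes> y" "(x \<otimes> y) \<otimes> E h = x \<otimes> y"
      using xy Eh hx yh by (simp_all add: m_assoc[symmetric]) (simp add: m_assoc yh)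
    ultimately have "E v \<otimes> (x \<otimes> y) = (x \<otimes> y) \<otimes> E v"
      using v h xy by (cases "v = h") (simp_all add: E_orth verts_double)
    then show ?thesis
      unfolding moment_factor_def x_def[symmetric] y_def[symmetric]
      using xy Ev by (simp add: l_distr r_distr)
  qed
  then show ?thesis using factor_unit[OF a] by (simp add: E_central_def)
qed

lemma E_central_pow: "a \<in> arcs (double Q) \<Longrightarrow> E_central (moment_factor R A a [^] sgn_arrow a)"
  using E_central_factor E_central_inv factor_unit by (simp add: pow_sgn_arrow)

lemma E_central_prod:
  "set ys \<subseteq> arcs (double Q) \<Longrightarrow> E_central (signed_prod R (moment_factor R A) ys)"
proof (induction ys)
  case Nil
  then show ?case using E_closed by (simp add: signed_prod_simps E_central_def verts_double)
qed (auto simp: signed_prod_simps intro!: E_central_mult E_central_pow)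

lemma E_central_commutes_sum:
  assumes "E_central c"
  shows "(\<Oplus>v\<in>verts Q. q v \<odot> E v) \<otimes> c = c \<otimes> (\<Oplus>v\<in>verts Q. q v \<odot> E v)"
proof -
  have c: "c \<in> carrier R" using assms by (auto simp: E_central_def)
  have E: "E v \<in> carrier R" if "v \<in> verts Q" for v using E_closed that by (simp add: verts_double)
  have "(\<Oplus>v\<in>verts Q. q v \<odot> E v) \<otimes> c = (\<Oplus>v\<in>verts Q. (q v \<odot> E v) \<otimes> c)"
    by (rule finsum_ldistr) (use c E finite_verts in \<open>auto simp: verts_double\<close>)
  also have "\<dots> = (\<Oplus>v\<in>verts Q. c \<otimes> (q v \<odot> E v))"
    by (rule finsum_cong')
      (use c E assms in \<open>auto simp: smult_mult_l smult_mult_r E_central_def\<close>)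
  also have "\<dots> = c \<otimes> (\<Oplus>v\<in>verts Q. q v \<odot> E v)"
    by (rule finsum_rdistr[symmetric]) (use c E finite_verts in \<open>auto simp: verts_double\<close>)
  finally show ?thesis .
qed

end

lemma mpp_rep_rotate:
  fixes R :: "('k::field, 'a) module" (structure)
  assumes rep: "mpp_rep R Q E A q (xs @ ys)" and arcs: "set (xs @ ys) \<subseteq> arcs (double Q)"
  shows "mpp_rep R Q E A q (ys @ xs)"
proof -
  interpret mpp_rep R Q E A q "xs @ ys" by (rule rep)
  let ?u = "moment_factor R A"
  define c d where "c = signed_prod R ?u xs" and "d = signed_prod R ?u ys"
  have unit: "\<And>a. a \<in> set (xs @ ys) \<Longrightarrow> ?u a \<in> Units R" using arcs factor_unit by blast
  have cd: "signed_prod R ?u (xs @ ys) = c \<otimes> d" "signed_prod R ?u (ys @ xs) = d \<otimes> c"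
    using unit by (auto simp: c_def d_def intro!: signed_prod_append)
  have c: "E_central c" and d: "E_central d"
    using arcs by (auto simp: c_def d_def intro!: E_central_prod)
  then have cu: "c \<in> Units R" "c \<in> carrier R" "d \<in> carrier R" by (auto simp: E_central_def)
  \<comment> \<open>By the relation \<open>c \<otimes> d\<close> is a combination of idempotents, so
    it commutes with \<open>c\<close>; cancelling the unit \<open>c\<close> then shows that
    \<open>c\<close> and \<open>d\<close> commute.\<close>
  have "c \<otimes> (c \<otimes> d) = (c \<otimes> d) \<otimes> c"
    using E_central_commutes_sum[OF c] relation by (simp add: cd)
  then have "c \<otimes> (c \<otimes> d) = c \<otimes> (d \<otimes> c)" using cu by (simp add: m_assoc)
  then have "c \<otimes> d = d \<otimes> c" using cu by (simp add: Units_l_cancel)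
  then have "signed_prod R ?u (ys @ xs) = (\<Oplus>v\<in>verts Q. q v \<odot> E v)"
    using relation cd by simp
  then show ?thesis
    by (intro mpp_rep.intro mpp_rep_axioms.intro quiver_rep_axioms factor_unit)
qed

lemma mpp_universal_rotate:
  fixes R :: "('k::field, 'a) module"
  assumes U: "mpp_universal Q q (xs @ ys) R E A" and arcs: "set (xs @ ys) \<subseteq> arcs (double Q)"
  shows "mpp_universal Q q (ys @ xs) R E A"
proof (rule mpp_universal_transfer[OF U mpp_rep_rotate[OF mpp_universal_rep[OF U] arcs] refl])
  fix S :: "('k, 'a) module" and E' B' assume "mpp_rep S Q E' B' q (ys @ xs)"
  then have "mpp_rep S Q E' B' q (xs @ ys)" by (rule mpp_rep_rotate) (use arcs in auto)
  then show "\<exists>A'. mpp_rep S Q E' A' q (xs @ ys) \<and>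
        (\<forall>f. algebra_hom R S f \<longrightarrow> (\<forall>a\<in>arcs (double Q). f (A a) = A' a) \<longrightarrow>
          (\<forall>a\<in>arcs (double Q). f (A a) = B' a))"
    by (intro exI[of _ B'] conjI allI impI)
next
  fix S :: "('k, 'a) module" and f g :: "'a \<Rightarrow> 'a" and a
  assume "\<And>a. a \<in> arcs (double Q) \<Longrightarrow> f (A a) = g (A a)" "a \<in> arcs (double Q)"
  then show "f (A a) = g (A a)" .
qed

lemma (in algebra_hom) hom_moment_factor:
  "C a \<in> carrier A \<Longrightarrow> C (star a) \<in> carrier A \<Longrightarrow>
    f (moment_factor A C a) = moment_factor B (\<lambda>a. f (C a)) a"
  by (simp add: moment_factor_def)

lemma moment_factor_cong:
  "C a = D a \<Longrightarrow> C (star a) = D (star a) \<Longrightarrow> moment_factor R C a = moment_factor R D a"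
  by (simp add: moment_factor_def)

subsection \<open>Exchanging two neighbouring arrows\<close>

text \<open>A base change by \<open>c\<close> at the head of \<open>a\<close>, felt only by that end
  of \<open>a\<close> and of \<open>star a\<close>.\<close>

definition twist ::
    "('k::field, 'a) module \<Rightarrow> ('e + 'e) \<Rightarrow> 'a \<Rightarrow> ('e + 'e \<Rightarrow> 'a) \<Rightarrow> 'e + 'e \<Rightarrow> 'a" where
  "twist R a c A b =
    (if b = a then inv\<^bsub>R\<^esub> c \<otimes>\<^bsub>R\<^esub> A a else if b = star a then A (star a) \<otimes>\<^bsub>R\<^esub> c else A b)"

lemma star_neq [simp]: "star a \<noteq> a" "a \<noteq> star a"
  by (cases a; simp)+

lemma star_eq_iff: "star a = b \<longleftrightarrow> a = star b"
  by (cases a; cases b) auto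

context mpp_rep
begin

text \<open>For \<open>a\<close> the elements \<open>inv c\<close> and \<open>c\<close> stand
  outside and conjugate the whole factor, as they also conjugate \<open>\<one>\<close> to itself.
  For \<open>star a\<close> they meet in the middle and cancel. Any other factor contains neither
  twisted arrow.\<close>

lemma moment_factor_twist:
  assumes c: "c \<in> Units R" and a: "a \<in> arcs (double Q)" and b: "b \<in> arcs (double Q)"
  shows "moment_factor R (twist R a c A) b =
    (if b = a then inv c \<otimes> moment_factor R A a \<otimes> c else moment_factor R A b)"
proof -
  have cl: "A a \<in> carrier R" "A (star a) \<in> carrier R" "c \<in> carrier R" "inv c \<in> carrier R"
    using a c by (auto simp: A_closed Units_closed)
  consider "b = a" | "b = star a" | "b \<noteq> a" "b \<noteq> star a" by blast
  then show ?thesis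
  proof cases
    case 1
    then show ?thesis using cl c
      by (simp add: moment_factor_def twist_def l_distr r_distr m_assoc)
  next
    case 2
    have "A (star a) \<otimes> c \<otimes> (inv c \<otimes> A a) = A (star a) \<otimes> (c \<otimes> inv c) \<otimes> A a"
      using cl by (simp add: m_assoc)
    then show ?thesis using cl c 2 by (simp add: moment_factor_def twist_def)
  next
    case 3
    then show ?thesis by (simp add: moment_factor_def twist_def star_eq_iff)
  qed
qed

lemma pow_conj:
  assumes c: "c \<in> Units R" and u: "u \<in> Units R"
  shows "(inv c \<otimes> u \<otimes> c) [^] sgn_arrow a = inv c \<otimes> u [^] sgn_arrow a \<otimes> c"
proof -
  have cl: "c \<in> carrier R" "u \<in> carrier R" "inv c \<in> carrier R" "inv u \<in> carrier R"
    using c u by auto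
  have conj: "(inv c \<otimes> v \<otimes> c) \<otimes> (inv c \<otimes> w \<otimes> c) = inv c \<otimes> (v \<otimes> w) \<otimes> c"
    if "v \<in> carrier R" "w \<in> carrier R" for v w
  proof -
    have "(inv c \<otimes> v \<otimes> c) \<otimes> (inv c \<otimes> w \<otimes> c) = inv c \<otimes> v \<otimes> (c \<otimes> inv c) \<otimes> w \<otimes> c"
      using cl that by (simp only: m_assoc m_closed)
    then show ?thesis using cl c that by (simp add: m_assoc)
  qed
  have "inv (inv c \<otimes> u \<otimes> c) = inv c \<otimes> inv u \<otimes> c"
    by (rule inv_char) (use cl c u in \<open>simp_all add: conj\<close>)
  then show ?thesis using c u by (simp add: pow_sgn_arrow)
qed

text \<open>Because \<open>c\<close> and \<open>inv c\<close> can be moved past the idempotent at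
  the head of \<open>a\<close>, the twisted arrows keep their endpoints. What remains is to compare
  the two products.\<close>

lemma twist_rep:
  assumes c: "E_central c" and a: "a \<in> arcs (double Q)"
    and rel: "signed_prod R (moment_factor R (twist R a c A)) ys =
      signed_prod R (moment_factor R A) xs"
  shows "mpp_rep R Q E (twist R a c A) q ys"
proof -
  have cu: "c \<in> Units R" and cE: "\<And>v. v \<in> verts Q \<Longrightarrow> E v \<otimes> c = c \<otimes> E v"
    and icE: "\<And>v. v \<in> verts Q \<Longrightarrow> E v \<otimes> inv c = inv c \<otimes> E v"
    using c E_central_inv[OF c] by (auto simp: E_central_def)
  have sa: "star a \<in> arcs (double Q)" using a by simp
  have cl: "A a \<in> carrier R" "A (star a) \<in> carrier R" "c \<in> carrier R" "inv c \<in> carrier R"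
    using a cu by (auto simp: A_closed Units_closed)
  have v: "head (double Q) a \<in> verts Q" "tail (double Q) a \<in> verts Q"
    using a head_in_verts[of a] tail_in_verts[of a] by (auto simp: verts_double)
  then have E: "E (head (double Q) a) \<in> carrier R" "E (tail (double Q) a) \<in> carrier R"
    using E_closed by (auto simp: verts_double)
  have 1: "E (head (double Q) a) \<otimes> (inv c \<otimes> A a) = inv c \<otimes> A a"
    using A_head[OF a] icE[OF v(1)] E cl by (metis m_assoc)
  have 2: "inv c \<otimes> A a \<otimes> E (tail (double Q) a) = inv c \<otimes> A a"
    using A_tail[OF a] E cl by (simp add: m_assoc)
  have 3: "E (tail (double Q) a) \<otimes> (A (star a) \<otimes> c) = A (star a) \<otimes> c"
    using A_head[OF sa] E cl by (simp add: m_assoc[symmetric])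
  have 4: "A (star a) \<otimes> c \<otimes> E (head (double Q) a) = A (star a) \<otimes> c"
    using A_tail[OF sa] cE[OF v(1)] E cl by (metis m_assoc star_double(3))
  show ?thesis
  proof unfold_locales
    show "moment_factor R (twist R a c A) b \<in> Units R" if "b \<in> arcs (double Q)" for b
      using that cu a factor_unit by (simp add: moment_factor_twist)
    show "signed_prod R (moment_factor R (twist R a c A)) ys = (\<Oplus>v\<in>verts Q. q v \<odot> E v)"
      using rel relation by simp
  qed (use 1 2 3 4 cl A_closed A_head A_tail E_closed E_orth E_sum in \<open>auto simp: twist_def\<close>)
qed

lemma twist_twist:
  assumes c: "c \<in> Units R" and a: "a \<in> arcs (double Q)" and b: "b \<in> arcs (double Q)"
  shows "twist R a (inv c) (twist R a c A) b = A b"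
proof -
  have cl: "A a \<in> carrier R" "A (star a) \<in> carrier R" "c \<in> carrier R" "inv c \<in> carrier R"
    using a c by (auto simp: A_closed Units_closed)
  have "c \<otimes> (inv c \<otimes> A a) = A a" using cl c by (simp add: m_assoc[symmetric])
  moreover have "A (star a) \<otimes> c \<otimes> inv c = A (star a)" using cl c by (simp add: m_assoc)
  ultimately show ?thesis using c by (simp add: twist_def)
qed

end

text \<open>
  Conjugating the factor of \<open>a\<close> by that of \<open>b\<close> moves \<open>b\<close> past \<open>a\<close>. The factor of \<open>a\<close> depends on
  \<open>A a\<close> and \<open>A (star a)\<close> only, and twisting these by \<open>c\<close> leaves the factor of \<open>star a\<close> unchanged.
\<close>

lemma mpp_rep_swap:
  fixes R :: "('k::field, 'a) module" (structure)
  assumes rep: "mpp_rep R Q E A q xs"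
    and arcs: "a \<in> arcs (double Q)" "b \<in> arcs (double Q)" "set (ys @ zs) \<subseteq> arcs (double Q)"
    and a: "a \<notin> set (ys @ zs)" "b \<noteq> a"
    and c: "c = moment_factor R A b [^] sgn_arrow b"
  shows "xs = ys @ [a, b] @ zs \<Longrightarrow> mpp_rep R Q E (twist R a c A) q (ys @ [b, a] @ zs)"
    and "xs = ys @ [b, a] @ zs \<Longrightarrow> mpp_rep R Q E (twist R a (inv c) A) q (ys @ [a, b] @ zs)"
proof -
  interpret mpp_rep R Q E A q xs by (rule rep)
  let ?P = "\<lambda>A. signed_prod R (moment_factor R A)" and ?u = "moment_factor R A"
  have cc: "E_central c" "E_central (inv c)"
    using E_central_pow[OF arcs(2)] E_central_inv by (simp_all add: c)
  have cu: "c \<in> Units R" "inv c \<in> Units R" "c \<in> carrier R" "inv c \<in> carrier R"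
    using cc by (auto simp: E_central_def)
  have split: "?P B (ys @ ws @ zs) = ?P B ys \<otimes> (?P B ws \<otimes> ?P B zs)"
    if "\<And>x. x \<in> arcs (double Q) \<Longrightarrow> moment_factor R B x \<in> Units R" "set ws \<subseteq> {a, b}" for B ws
  proof -
    have "\<And>x. x \<in> set (ys @ ws @ zs) \<Longrightarrow> moment_factor R B x \<in> Units R"
      using that arcs by auto
    then show ?thesis by (subst signed_prod_append, force)+ (rule refl)
  qed
  have twist_unit: "moment_factor R (twist R a d A) x \<in> Units R"
    if "x \<in> arcs (double Q)" "d \<in> Units R" for d x
    using that arcs(1) factor_unit by (simp add: moment_factor_twist)
  have twist_prod: "?P (twist R a d A) ws = ?P A ws" if "d \<in> Units R" "set ws \<subseteq> set (ys @ zs)" for d ws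
    using that a(1) arcs by (intro signed_prod_cong) (auto simp: moment_factor_twist subset_iff)
  define x where "x = ?u a [^] sgn_arrow a"
  have x: "x \<in> carrier R" unfolding x_def using factor_unit[OF arcs(1)] pow_sgn_arrow_unit by blast
  have Z: "?P A ys \<in> carrier R" "?P A zs \<in> carrier R"
    using arcs factor_unit by (auto intro!: signed_prod_closed)
  have pa: "moment_factor R (twist R a d A) a [^] sgn_arrow a = inv d \<otimes> x \<otimes> d" if "d \<in> Units R" for d
    using that arcs(1) factor_unit by (simp add: moment_factor_twist pow_conj x_def)
  have pb: "moment_factor R (twist R a d A) b [^] sgn_arrow b = c" if "d \<in> Units R" for d
    using that arcs a(2) by (simp add: moment_factor_twist c)
  show "mpp_rep R Q E (twist R a c A) q (ys @ [b, a] @ zs)" if xs: "xs = ys @ [a, b] @ zs"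
  proof (rule twist_rep[OF cc(1) arcs(1)])
    \<comment> \<open>The signed factor of \<open>b\<close> is still \<open>c\<close>. It cancels
      the \<open>inv c\<close> of the conjugated factor and reappears on the right.\<close>
    have "?P (twist R a c A) [b, a] = c \<otimes> (inv c \<otimes> x \<otimes> c)"
      using cu x by (simp add: signed_prod_simps pa pb)
    also have "\<dots> = x \<otimes> c"
      using cu x by (simp add: m_assoc[symmetric])
    also have "\<dots> = ?P A [a, b]" using cu by (simp add: signed_prod_simps x_def c)
    finally have "?P (twist R a c A) [b, a] = ?P A [a, b]" .
    then show "?P (twist R a c A) (ys @ [b, a] @ zs) = ?P A xs"
      unfolding xs using twist_unit cu factor_unit
      by (subst (1 2) split) (auto simp: twist_prod)
  qed
  show "mpp_rep R Q E (twist R a (inv c) A) q (ys @ [a, b] @ zs)" if xs: "xs = ys @ [b, a] @ zs"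
  proof (rule twist_rep[OF cc(2) arcs(1)])
    \<comment> \<open>Twisting by \<open>inv c\<close> conjugates the other way, so now the trailing
      \<open>inv c\<close> meets the factor of \<open>b\<close>.\<close>
    have "?P (twist R a (inv c) A) [a, b] = c \<otimes> x \<otimes> inv c \<otimes> c"
      using cu x by (simp add: signed_prod_simps pa pb)
    also have "\<dots> = c \<otimes> x"
      using cu x by (simp add: m_assoc)
    also have "\<dots> = ?P A [b, a]"
      using factor_unit[OF arcs(1)] by (simp add: signed_prod_simps x_def c pow_sgn_arrow_unit Units_closed)
    finally have "?P (twist R a (inv c) A) [a, b] = ?P A [b, a]" .
    then show "?P (twist R a (inv c) A) (ys @ [a, b] @ zs) = ?P A xs"
      unfolding xs using twist_unit cu factor_unit
      by (subst (1 2) split) (auto simp: twist_prod)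
  qed
qed

text \<open>To undo the twist, \<open>c\<close> must be computable from the twisted family. As
  \<open>b\<close> is neither \<open>a\<close> nor \<open>star a\<close>, its factor is formed from
  untwisted arrows only, so both families yield the same \<open>c\<close>.\<close>

lemma mpp_universal_swap:
  fixes R :: "('k::field, 'a) module" (structure)
  assumes U: "mpp_universal Q q (ys @ [a, b] @ zs) R E A"
    and arcs: "set (ys @ [a, b] @ zs) \<subseteq> arcs (double Q)"
    and dist: "distinct (ys @ [a, b] @ zs)" and b: "b \<noteq> star a"
  shows "\<exists>B. mpp_universal Q q (ys @ [b, a] @ zs) R E B"
proof -
  let ?c = "\<lambda>S A. moment_factor S A b [^]\<^bsub>S\<^esub> sgn_arrow b"
  have ar: "a \<in> arcs (double Q)" "b \<in> arcs (double Q)" "set (ys @ zs) \<subseteq> arcs (double Q)"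
    and ab: "a \<notin> set (ys @ zs)" "b \<noteq> a"
    using arcs dist by auto
  have b_twist: "moment_factor S (twist S a d B) b = moment_factor S B b"
    for S :: "('k, 'a) module" and d B
    using ab(2) b by (intro moment_factor_cong) (auto simp: twist_def star_eq_iff)
  have hom_c: "f (?c S B) = ?c T C"
    if f: "algebra_hom S T f" and rep: "mpp_rep S Q E' B q ws" and fB: "f (B b) = C b" "f (B (star b)) = C (star b)"
    for S T :: "('k, 'a) module" and f E' B C ws
  proof -
    interpret f: algebra_hom S T f by (rule f)
    interpret S: mpp_rep S Q E' B q ws by (rule rep)
    have "f (moment_factor S B b) = moment_factor T (\<lambda>a. f (B a)) b"
      using S.A_closed ar(2) by (intro f.hom_moment_factor) auto
    also have "\<dots> = moment_factor T C b" using fB by (intro moment_factor_cong) auto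
    finally show ?thesis using S.factor_unit[OF ar(2)] by (simp add: f.hom_pow_sgn_arrow)
  qed
  have hom_twist: "f (twist S a d B x) = twist T a e C x"
    if f: "algebra_hom S T f" and rep: "mpp_rep S Q E' B q ws" and d: "d \<in> Units S" "f d = e"
      and fB: "\<And>x. x \<in> arcs (double Q) \<Longrightarrow> f (B x) = C x" and x: "x \<in> arcs (double Q)"
    for S T :: "('k, 'a) module" and f E' B C ws d e x
  proof -
    interpret f: algebra_hom S T f by (rule f)
    interpret S: mpp_rep S Q E' B q ws by (rule rep)
    show ?thesis
      using S.A_closed ar(1) x fB d f.A.Units_closed[OF d(1)] f.A.Units_inv_closed[OF d(1)]
      by (simp add: twist_def f.hom_inv)
  qed
  define c where "c = ?c R A"
  define B where "B = twist R a c A"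
  interpret R: mpp_rep R Q E A q "ys @ [a, b] @ zs" by (rule mpp_universal_rep[OF U])
  have cu: "c \<in> Units R" unfolding c_def using R.factor_unit[OF ar(2)] by (rule R.pow_sgn_arrow_unit)
  have cB: "c = ?c R B" by (simp add: c_def B_def b_twist)
  have repB: "mpp_rep R Q E B q (ys @ [b, a] @ zs)"
    unfolding B_def by (rule mpp_rep_swap(1)[OF R.mpp_rep_axioms ar ab c_def refl])
  have AB: "twist R a (inv c) B x = A x" if "x \<in> arcs (double Q)" for x
    unfolding B_def by (rule R.twist_twist[OF cu ar(1) that])
  have "mpp_universal Q q (ys @ [b, a] @ zs) R E B"
  proof (rule mpp_universal_transfer[OF U repB refl])
    fix S :: "('k, 'a) module" and E' B' assume rep: "mpp_rep S Q E' B' q (ys @ [b, a] @ zs)"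
    interpret S: mpp_rep S Q E' B' q "ys @ [b, a] @ zs" by (rule rep)
    define d where "d = ?c S B'"
    define A' where "A' = twist S a (inv\<^bsub>S\<^esub> d) B'"
    have du: "d \<in> Units S" unfolding d_def using S.factor_unit[OF ar(2)] by (rule S.pow_sgn_arrow_unit)
    have dA: "d = ?c S A'" by (simp add: d_def A'_def b_twist)
    have A': "mpp_rep S Q E' A' q (ys @ [a, b] @ zs)"
      unfolding A'_def by (rule mpp_rep_swap(2)[OF rep ar ab d_def refl])
    have "f (B x) = B' x"
      if f: "algebra_hom R S f" and fA: "\<And>x. x \<in> arcs (double Q) \<Longrightarrow> f (A x) = A' x"
        and x: "x \<in> arcs (double Q)" for f x
    proof -
      have "f c = d"
        unfolding c_def dA using ar(2)
        by (intro hom_c[OF f R.mpp_rep_axioms] fA) simp_all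
      then have "f (B x) = twist S a d A' x"
        unfolding B_def by (intro hom_twist[OF f R.mpp_rep_axioms cu _ fA x])
      also have "\<dots> = B' x"
        using S.twist_twist[OF S.Units_inv_Units[OF du] ar(1) x] du by (simp add: A'_def)
      finally show ?thesis .
    qed
    with A' show "\<exists>A'. mpp_rep S Q E' A' q (ys @ [a, b] @ zs) \<and>
        (\<forall>f. algebra_hom R S f \<longrightarrow> (\<forall>a\<in>arcs (double Q). f (A a) = A' a) \<longrightarrow>
          (\<forall>a\<in>arcs (double Q). f (B a) = B' a))"
      by blast
  next
    fix S :: "('k, 'a) module" and f g x
    assume f: "algebra_hom R S f" and g: "algebra_hom R S g"
      and fg: "\<And>a. a \<in> arcs (double Q) \<Longrightarrow> f (B a) = g (B a)" and x: "x \<in> arcs (double Q)"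
    interpret f: algebra_hom R S f by (rule f)
    interpret g: algebra_hom R S g by (rule g)
    \<comment> \<open>Reading \<open>c\<close> off from \<open>B\<close>, where \<open>f\<close> and
      \<open>g\<close> agree, shows that both send it to the same element.\<close>
    have "f c = ?c S (\<lambda>a. g (B a))" "g c = ?c S (\<lambda>a. g (B a))"
      unfolding cB using ar(2)
      by (intro hom_c[OF f repB] fg; simp) (intro hom_c[OF g repB]; simp)
    then have "f (inv c) = g (inv c)" using cu by (simp add: f.hom_inv g.hom_inv)
    then have "f (twist R a (inv c) B x) = twist S a (g (inv c)) (\<lambda>a. g (B a)) x"
      by (intro hom_twist[OF f repB _ _ fg x]) (simp_all add: cu)
    moreover have "g (twist R a (inv c) B x) = twist S a (g (inv c)) (\<lambda>a. g (B a)) x"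
      by (intro hom_twist[OF g repB _ _ refl x]) (simp_all add: cu)
    ultimately show "f (A x) = g (A x)" by (simp add: AB x)
  qed
  then show ?thesis by blast
qed

subsection \<open>Arbitrary reorderings\<close>

text \<open>The combinatorial core, independent of algebras: rotations supply the exchanges of
  \<open>a\<close> with \<open>star a\<close> that \<open>swap\<close> excludes, and adjacent
  exchanges generate all permutations.\<close>

lemma permute_by_swaps:
  fixes P :: "('e + 'e) list \<Rightarrow> bool"
  assumes rot: "\<And>xs ys. P (xs @ ys) \<Longrightarrow> P (ys @ xs)"
    and swap: "\<And>xs a b ys. P (xs @ [a, b] @ ys) \<Longrightarrow> distinct (xs @ [a, b] @ ys) \<Longrightarrow> b \<noteq> star a \<Longrightarrow>
      P (xs @ [b, a] @ ys)"
    and xs: "P xs" "distinct xs" and ys: "distinct ys" "set ys = set xs"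
  shows "P ys"
proof -
  have move: "P (xs @ zs @ [a] @ ys) \<Longrightarrow> distinct (xs @ zs @ [a] @ ys) \<Longrightarrow> star a \<notin> set zs \<Longrightarrow>
      P (xs @ [a] @ zs @ ys)" for xs zs a ys
  proof (induction zs arbitrary: ys rule: rev_induct)
    case (snoc z zs)
    have "a \<noteq> star z" using snoc.prems(3) by auto
    then have "P ((xs @ zs) @ [a, z] @ ys)"
      using snoc.prems by (intro swap[of "xs @ zs" z a ys]) auto
    then show ?case using snoc.prems snoc.IH[of "z # ys"] by auto
  qed simp
  \<comment> \<open>\<open>a\<close> and \<open>star a\<close> cannot be exchanged directly, but \<open>a\<close> can travel around the whole circle.\<close>
  have swap_any: "P (xs @ [b, a] @ ys)" if P: "P (xs @ [a, b] @ ys)" and d: "distinct (xs @ [a, b] @ ys)"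
    for xs a b ys
  proof (cases "b = star a")
    case True
    \<comment> \<open>The circle is cut just before \<open>b\<close>, which puts \<open>a\<close>
      last. The block between them is free of \<open>star a\<close>, because \<open>b\<close> is its
      only occurrence in a distinct list.\<close>
    have "P ([b] @ (ys @ xs) @ [a] @ [])"
      using rot[of "xs @ [a]" "[b] @ ys"] P by simp
    then have "P ([b] @ [a] @ (ys @ xs) @ [])"
      by (rule move) (use d True in auto)
    then show ?thesis using rot[of "[b, a] @ ys" xs] by simp
  qed (use swap[OF P d] in simp)
  have move_any: "P (xs @ zs @ [a] @ ys) \<Longrightarrow> distinct (xs @ zs @ [a] @ ys) \<Longrightarrow>
      P (xs @ [a] @ zs @ ys)" for xs zs a ys
  proof (induction zs arbitrary: ys rule: rev_induct)
    case (snoc z zs)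
    have "P ((xs @ zs) @ [a, z] @ ys)"
      using snoc.prems by (intro swap_any[of "xs @ zs" z a ys]) auto
    then show ?case using snoc.prems snoc.IH[of "z # ys"] by auto
  qed simp
  \<comment> \<open>Selection sort: \<open>us\<close> is already in final position, and the next
    entry of \<open>ys\<close> is pulled to the front of the remainder.\<close>
  have "P (us @ xs) \<Longrightarrow> distinct (us @ xs) \<Longrightarrow> distinct ys \<Longrightarrow> set ys = set xs \<Longrightarrow> P (us @ ys)" for us xs
  proof (induction ys arbitrary: us xs)
    case (Cons y ys)
    have "y \<in> set xs" using Cons.prems(4) by auto
    then obtain x1 x2 where x: "xs = x1 @ [y] @ x2" by (metis append_Cons append_Nil split_list)
    have "P (us @ [y] @ x1 @ x2)" using Cons.prems(1,2) x by (intro move_any) auto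
    then have 1: "P ((us @ [y]) @ (x1 @ x2))" by simp
    have 2: "distinct ((us @ [y]) @ (x1 @ x2))" "set ys = set (x1 @ x2)"
      using Cons.prems(2-4) x by auto
    have "P ((us @ [y]) @ ys)"
      by (rule Cons.IH[OF 1 2(1) _ 2(2)]) (use Cons.prems(3) in simp)
    then show ?case by simp
  qed simp
  from this[of "[]" xs] show ?thesis using xs ys by simp
qed

lemma mpp_universal_permute:
  assumes U: "mpp_universal Q q xs R E A"
    and xs: "distinct xs" "set xs \<subseteq> arcs (double Q)" and ys: "distinct ys" "set ys = set xs"
  shows "\<exists>B. mpp_universal Q q ys R E B"
proof -
  let ?P = "\<lambda>xs. set xs \<subseteq> arcs (double Q) \<and> (\<exists>A. mpp_universal Q q xs R E A)"
  have "?P ys"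
  proof (rule permute_by_swaps[where P = ?P, OF _ _ _ xs(1) ys])
    show "?P (ys @ xs)" if "?P (xs @ ys)" for xs ys
      using that mpp_universal_rotate[of Q q xs ys R E] by auto
    show "?P (xs @ [b, a] @ ys)" if "?P (xs @ [a, b] @ ys)" "distinct (xs @ [a, b] @ ys)" "b \<noteq> star a"
      for xs a b ys
      using that mpp_universal_swap[of Q q xs a b ys R E] by auto
    show "?P xs" using U xs(2) by blast
  qed
  then show ?thesis by blast
qed

section \<open>Increasing enumerations of finite strict linear orders\<close>

lemma strict_linear_order_sorted_list:
  assumes "finite A" "strict_linear_order_on A r"
  shows "\<exists>xs. set xs = A \<and> distinct xs \<and> sorted_wrt (\<lambda>x y. (x, y) \<in> r) xs"
  using assms
proof (induction A rule: finite_induct)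
  case (insert x A)
  have r: "trans r" "irrefl r" "total_on (insert x A) r"
    using insert.prems by (auto simp: strict_linear_order_on_def)
  then have "strict_linear_order_on A r"
    by (auto simp: strict_linear_order_on_def total_on_def)
  then obtain xs where xs: "set xs = A" "distinct xs" "sorted_wrt (\<lambda>x y. (x, y) \<in> r) xs"
    using insert.IH by blast
  \<comment> \<open>Insertion of \<open>x\<close> between the smaller and the remaining elements.
    Totality places the latter above \<open>x\<close>, and transitivity compares the two
    parts.\<close>
  let ?ys = "filter (\<lambda>y. (y, x) \<in> r) xs @ x # filter (\<lambda>y. (y, x) \<notin> r) xs"
  have gt: "(x, y) \<in> r" if "y \<in> A" "(y, x) \<notin> r" for y
    using r(3) that insert.hyps(2) by (auto simp: total_on_def)
  have "set ?ys = insert x A" "distinct ?ys" using xs insert.hyps(2) by auto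
  moreover have "sorted_wrt (\<lambda>x y. (x, y) \<in> r) ?ys"
    using xs gt r(1) by (auto simp: sorted_wrt_append sorted_wrt_filter dest: transD)
  ultimately show ?case by blast
qed auto

lemma increasing_list_props:
  assumes A: "finite A" and r: "strict_linear_order_on A r"
  shows "set (increasing_list A r) = A" "distinct (increasing_list A r)"
proof -
  have tr: "trans r" and irr: "irrefl r" using r by (auto simp: strict_linear_order_on_def)
  \<comment> \<open>\<open>increasing_list\<close> is a definite description, so nothing can be read
    off from it before uniqueness is known.\<close>
  have unique: "xs = ys"
    if "set xs = set ys" "distinct xs" "distinct ys" "sorted_wrt (\<lambda>x y. (x, y) \<in> r) xs"
      "sorted_wrt (\<lambda>x y. (x, y) \<in> r) ys" for xs ys
    using that
  proof (induction xs arbitrary: ys)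
    case (Cons x xs)
    then obtain y zs where y: "ys = y # zs" by (cases ys) auto
    have "x = y"
    proof (rule ccontr)
      assume "x \<noteq> y"
      then have "(x, y) \<in> r" "(y, x) \<in> r" using Cons.prems y by (auto simp: set_eq_iff)
      then show False using tr irr by (meson irreflD transD)
    qed
    moreover from this have "set xs = set zs" using Cons.prems y by auto
    ultimately show ?case using Cons.IH[of zs] Cons.prems y by auto
  qed simp
  let ?Q = "\<lambda>xs. set xs = A \<and> distinct xs \<and> sorted_wrt (\<lambda>x y. (x, y) \<in> r) xs"
  obtain zs where zs: "?Q zs" using strict_linear_order_sorted_list[OF A r] by blast
  have "?Q (THE xs. ?Q xs)"
    by (rule theI[of ?Q, OF zs]) (use zs unique in auto)
  then show "set (increasing_list A r) = A" "distinct (increasing_list A r)"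
    by (auto simp: increasing_list_def)
qed

subsection \<open>Reversing arrows\<close>

definition reversed_in :: "'e set \<Rightarrow> 'e + 'e \<Rightarrow> bool" where
  "reversed_in X x \<longleftrightarrow> case_sum id id x \<in> X"

text \<open>Both doubles use the labels \<open>Inl a\<close> and \<open>Inr a\<close>, but for
  \<open>a\<close> in \<open>X\<close> the two labels exchange their endpoints when the quiver is
  reversed. \<open>flip\<close> translates the labels, and with them the signs.\<close>

definition flip :: "'e set \<Rightarrow> 'e + 'e \<Rightarrow> 'e + 'e" where
  "flip X x = (if reversed_in X x then star x else x)"

lemma reversed_in_star [simp]: "reversed_in X (star x) = reversed_in X x"
  by (cases x) (auto simp: reversed_in_def)

lemma flip_flip [simp]: "flip X (flip X x) = x"
  by (simp add: flip_def)

lemma double_reverse: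
  "verts (reverse_arrows X Q) = verts Q"
  "verts (double (reverse_arrows X Q)) = verts (double Q)"
  "arcs (double (reverse_arrows X Q)) = arcs (double Q)"
  "head (double (reverse_arrows X Q)) x = head (double Q) (flip X x)"
  "tail (double (reverse_arrows X Q)) x = tail (double Q) (flip X x)"
  by (cases x; auto simp: double_def reverse_arrows_def flip_def reversed_in_def)+

lemma flip_arcs [simp]: "flip X x \<in> arcs (double Q) \<longleftrightarrow> x \<in> arcs (double Q)"
  by (simp add: flip_def)

lemma reverse_reverse: "reverse_arrows X (reverse_arrows X Q) = Q"
  by (rule pre_digraph.equality) (auto simp: reverse_arrows_def)

lemma fin_digraph_reverse:
  assumes "fin_digraph Q" shows "fin_digraph (reverse_arrows X Q)"
proof -
  interpret fin_digraph Q by fact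
  show ?thesis by unfold_locales (auto simp: reverse_arrows_def)
qed

text \<open>
  Reversal is not an involution: its inverse is the same operation with the roles of the two arrows
  exchanged, whence the parameter \<open>s\<close>, which selects one arrow of each pair.
\<close>

definition reverse_rep ::
    "('k::field, 'a) module \<Rightarrow> ('e + 'e \<Rightarrow> bool) \<Rightarrow> 'e set \<Rightarrow> ('e + 'e \<Rightarrow> 'a) \<Rightarrow> 'e + 'e \<Rightarrow> 'a" where
  "reverse_rep R s X A x =
    (if reversed_in X x then
      if s x then A (star x)
      else \<ominus>\<^bsub>R\<^esub> (inv\<^bsub>R\<^esub> moment_factor R A (star x) \<otimes>\<^bsub>R\<^esub> A (star x))
     else A x)"

context mpp_rep
begin

lemma reverse_rep_closed:
  "x \<in> arcs (double Q) \<Longrightarrow> reverse_rep R s X A x \<in> carrier R"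
  using A_closed[of x] A_closed[of "star x"] factor_unit[of "star x"]
  by (simp add: reverse_rep_def)

text \<open>The premise on \<open>s\<close> makes it select exactly one arrow of each pair. The two
  cases are the two identities of \<open>inv_one_plus_swap\<close>, the second with the roles of
  \<open>x\<close> and \<open>star x\<close> exchanged.\<close>

lemma moment_factor_reverse:
  assumes s: "\<And>x. s (star x) \<longleftrightarrow> \<not> s x" and x: "x \<in> arcs (double Q)"
  shows "moment_factor R (reverse_rep R s X A) x =
    (if reversed_in X x then inv moment_factor R A (star x) else moment_factor R A x)"
proof (cases "reversed_in X x")
  case True
  have cl: "A x \<in> carrier R" "A (star x) \<in> carrier R" using x A_closed by auto
  have u: "\<one> \<oplus> A x \<otimes> A (star x) \<in> Units R" "\<one> \<oplus> A (star x) \<otimes> A x \<in> Units R"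
    using factor_unit[OF x] factor_unit[of "star x"] x by (simp_all add: moment_factor_def)
  show ?thesis
  proof (cases "s x")
    case sx: True
    then show ?thesis
      using True s inv_one_plus_swap(2)[OF cl u] by (simp add: moment_factor_def reverse_rep_def)
  next
    case sx: False
    then show ?thesis
      using True s inv_one_plus_swap(1)[OF cl(2,1) u(2,1)]
      by (simp add: moment_factor_def reverse_rep_def)
  qed
qed (auto simp: moment_factor_def reverse_rep_def)

text \<open>For a reversed arrow the factor is inverted and the sign of its label changes, so its
  signed factor is the same element of \<open>R\<close> as before. Thus the relation persists term
  by term, with the labels flipped and the order kept.\<close>

lemma reverse_rep_rep:
  assumes s: "\<And>x. s (star x) \<longleftrightarrow> \<not> s x" and xs: "set xs \<subseteq> arcs (double Q)"
  shows "mpp_rep R (reverse_arrows X Q) E (reverse_rep R s X A) q (map (flip X) xs)"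
proof -
  let ?B = "reverse_rep R s X A"
  interpret Q': wf_digraph "double (reverse_arrows X Q)"
    by unfold_locales (simp_all add: double_reverse)
  have pow: "moment_factor R ?B (flip X x) [^] sgn_arrow (flip X x) = moment_factor R A x [^] sgn_arrow x"
    if x: "x \<in> arcs (double Q)" for x
  proof (cases "reversed_in X x")
    case True
    have u: "moment_factor R A x \<in> Units R" using factor_unit[OF x] .
    have "moment_factor R ?B (star x) = inv moment_factor R A x"
      using moment_factor_reverse[where s = s, OF s, of "star x" X] True x by simp
    moreover have "sgn_arrow (star x) = 1 \<longleftrightarrow> sgn_arrow x \<noteq> 1" by (cases x) auto
    ultimately show ?thesis
      using True u by (simp add: flip_def pow_sgn_arrow)
  next
    case False
    then show ?thesis using x by (simp add: moment_factor_reverse[where s = s, OF s] flip_def)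
  qed
  have prod: "signed_prod R (moment_factor R ?B) (map (flip X) xs) = signed_prod R (moment_factor R A) xs"
    using xs by (induction xs) (simp_all add: signed_prod_simps pow)
  have E_inv: "E (head (double Q) a) \<otimes> (inv moment_factor R A a \<otimes> A a) = inv moment_factor R A a \<otimes> A a"
    "inv moment_factor R A a \<otimes> A a \<otimes> E (tail (double Q) a) = inv moment_factor R A a \<otimes> A a"
    if a: "a \<in> arcs (double Q)" for a
  proof -
    have h: "head (double Q) a \<in> verts Q" "tail (double Q) a \<in> verts Q"
      using head_in_verts[OF a] tail_in_verts[OF a] by (simp_all add: verts_double)
    have cl: "E (head (double Q) a) \<in> carrier R" "E (tail (double Q) a) \<in> carrier R" "A a \<in> carrier R"
      "inv moment_factor R A a \<in> carrier R"
      using h a E_closed A_closed factor_unit[OF a] by (simp_all add: verts_double)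
    have "E (head (double Q) a) \<otimes> inv moment_factor R A a = inv moment_factor R A a \<otimes> E (head (double Q) a)"
      using E_central_inv[OF E_central_factor[OF a]] h by (simp add: E_central_def)
    then show "E (head (double Q) a) \<otimes> (inv moment_factor R A a \<otimes> A a) = inv moment_factor R A a \<otimes> A a"
      using A_head[OF a] cl by (metis m_assoc)
    show "inv moment_factor R A a \<otimes> A a \<otimes> E (tail (double Q) a) = inv moment_factor R A a \<otimes> A a"
      using A_tail[OF a] cl by (simp add: m_assoc)
  qed
  have head: "E (head (double Q) (flip X x)) \<otimes> ?B x = ?B x"
    and tail: "?B x \<otimes> E (tail (double Q) (flip X x)) = ?B x" if x: "x \<in> arcs (double Q)" for x
  proof -
    have sx: "star x \<in> arcs (double Q)" using x by simp
    have cl: "E (head (double Q) (star x)) \<in> carrier R" "E (tail (double Q) (star x)) \<in> carrier R"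
      "A (star x) \<in> carrier R" "inv moment_factor R A (star x) \<in> carrier R"
      using E_closed A_closed[OF sx] factor_unit[OF sx] head_in_verts[OF sx] tail_in_verts[OF sx] by auto
    show "E (head (double Q) (flip X x)) \<otimes> ?B x = ?B x"
      using A_head[OF sx] A_head[OF x] E_inv(1)[OF sx] cl
      by (simp add: reverse_rep_def flip_def r_minus del: star_double)
    show "?B x \<otimes> E (tail (double Q) (flip X x)) = ?B x"
      using A_tail[OF sx] A_tail[OF x] E_inv(2)[OF sx] cl
      by (simp add: reverse_rep_def flip_def l_minus del: star_double)
  qed
  show ?thesis
  proof unfold_locales
    show "moment_factor R ?B x \<in> Units R" if "x \<in> arcs (double (reverse_arrows X Q))" for x
      using that factor_unit by (simp add: double_reverse moment_factor_reverse[where s = s, OF s])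
  qed (use E_closed E_orth E_sum finite_verts reverse_rep_closed head tail relation prod
        in \<open>auto simp: double_reverse\<close>)
qed

text \<open>One arrow of a pair is merely exchanged twice. The other was multiplied by
  \<open>inv u\<close> and negated; the factor of the reversed family is \<open>inv u\<close>, so
  the way back multiplies by \<open>u\<close> and negates again.\<close>

lemma reverse_rep_reverse:
  assumes s: "\<And>x. s (star x) \<longleftrightarrow> \<not> s x" and x: "x \<in> arcs (double Q)"
  shows "reverse_rep R (\<lambda>x. \<not> s x) X (reverse_rep R s X A) x = A x"
proof (cases "reversed_in X x \<and> s x")
  case True
  have u: "moment_factor R A x \<in> Units R" using factor_unit[OF x] .
  have Ax: "A x \<in> carrier R" using A_closed[OF x] .
  let ?u = "moment_factor R A x"
  have "reverse_rep R (\<lambda>x. \<not> s x) X (reverse_rep R s X A) x =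
      \<ominus> (inv moment_factor R (reverse_rep R s X A) (star x) \<otimes> \<ominus> (inv ?u \<otimes> A x))"
    using True s by (simp add: reverse_rep_def[of R "\<lambda>x. \<not> s x"]) (simp add: reverse_rep_def)
  also have "moment_factor R (reverse_rep R s X A) (star x) = inv ?u"
    using moment_factor_reverse[where s = s, OF s, of "star x" X] True x by simp
  also have "\<ominus> (inv (inv ?u) \<otimes> \<ominus> (inv ?u \<otimes> A x)) = ?u \<otimes> (inv ?u \<otimes> A x)"
    using u Ax by (simp add: r_minus Units_closed)
  also have "\<dots> = A x" using u Ax by (simp add: m_assoc[symmetric] Units_closed)
  finally show ?thesis .
next
  case False
  then show ?thesis using s by (auto simp: reverse_rep_def)
qed

end

text \<open>Naturality: the reversed family is given by ring operations and inverses of units, all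
  of which homomorphisms preserve.\<close>

lemma reverse_rep_hom:
  assumes f: "algebra_hom R S f" and rep: "mpp_rep R Q E A q xs"
    and fA: "\<And>x. x \<in> arcs (double Q) \<Longrightarrow> f (A x) = C x" and x: "x \<in> arcs (double Q)"
  shows "f (reverse_rep R s X A x) = reverse_rep S s X C x"
proof -
  interpret f: algebra_hom R S f by (rule f)
  interpret R: mpp_rep R Q E A q xs by (rule rep)
  have sx: "star x \<in> arcs (double Q)" using x by simp
  have "f (moment_factor R A (star x)) = moment_factor S C (star x)"
    using R.A_closed[OF x] R.A_closed[OF sx] fA[OF x] fA[OF sx]
    by (simp add: f.hom_moment_factor) (simp add: moment_factor_def)
  then show ?thesis
    using R.A_closed[OF sx] R.factor_unit[OF sx] fA[OF x] fA[OF sx]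
    by (simp add: reverse_rep_def f.hom_inv)
qed

lemma mpp_universal_reverse:
  fixes R :: "('k::field, 'a) module" (structure) and Q :: "('v, 'e) pre_digraph"
  assumes U: "mpp_universal Q q xs R E A" and xs: "set xs \<subseteq> arcs (double Q)"
  shows "mpp_universal (reverse_arrows X Q) q (map (flip X) xs) R E (reverse_rep R isl X A)"
proof -
  \<comment> \<open>\<open>isl\<close> selects the arrow labelled \<open>Inl\<close> in each pair
    and serves for the passage to the reversed quiver; its negation serves for the way back.\<close>
  have s: "isl (star x) \<longleftrightarrow> \<not> isl x" and s': "(\<not> isl (star x)) \<longleftrightarrow> \<not> \<not> isl x" for x :: "'e + 'e"
    by (cases x; simp)+
  define B where "B = reverse_rep R isl X A"
  interpret R: mpp_rep R Q E A q xs by (rule mpp_universal_rep[OF U])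
  have repB: "mpp_rep R (reverse_arrows X Q) E B q (map (flip X) xs)"
    unfolding B_def by (rule R.reverse_rep_rep[where s = isl, OF s xs])
  have AB: "reverse_rep R (\<lambda>x. \<not> isl x) X B x = A x" if "x \<in> arcs (double Q)" for x
    unfolding B_def by (rule R.reverse_rep_reverse[where s = isl, OF s that])
  have "mpp_universal (reverse_arrows X Q) q (map (flip X) xs) R E B"
  proof (rule mpp_universal_transfer[OF U repB double_reverse(1)])
    fix S :: "('k, 'a) module" and E' B'
    assume "mpp_rep S (reverse_arrows X Q) E' B' q (map (flip X) xs)"
    then interpret S: mpp_rep S "reverse_arrows X Q" E' B' q "map (flip X) xs" .
    define A' where "A' = reverse_rep S (\<lambda>x. \<not> isl x) X B'"
    have "mpp_rep S (reverse_arrows X (reverse_arrows X Q)) E' A' q (map (flip X) (map (flip X) xs))"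
      unfolding A'_def by (rule S.reverse_rep_rep[where s = "\<lambda>x. \<not> isl x", OF s']) (use xs in \<open>auto simp: double_reverse\<close>)
    then have A': "mpp_rep S Q E' A' q xs"
      by (simp add: reverse_reverse comp_def)
    have "f (B x) = B' x"
      if f: "algebra_hom R S f" and fA: "\<And>x. x \<in> arcs (double Q) \<Longrightarrow> f (A x) = A' x"
        and x: "x \<in> arcs (double (reverse_arrows X Q))" for f x
    proof -
      have "f (B x) = reverse_rep S isl X A' x"
        unfolding B_def by (rule reverse_rep_hom[OF f R.mpp_rep_axioms fA]) (use x in \<open>simp_all add: double_reverse\<close>)
      also have "\<dots> = B' x"
        unfolding A'_def using S.reverse_rep_reverse[where s = "\<lambda>x. \<not> isl x", OF s' x] by simp
      finally show ?thesis .
    qed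
    with A' show "\<exists>A'. mpp_rep S Q E' A' q xs \<and>
        (\<forall>f. algebra_hom R S f \<longrightarrow> (\<forall>a\<in>arcs (double Q). f (A a) = A' a) \<longrightarrow>
          (\<forall>a\<in>arcs (double (reverse_arrows X Q)). f (B a) = B' a))"
      by blast
  next
    fix S :: "('k, 'a) module" and f g x
    assume f: "algebra_hom R S f" and g: "algebra_hom R S g"
      and fg: "\<And>a. a \<in> arcs (double (reverse_arrows X Q)) \<Longrightarrow> f (B a) = g (B a)"
      and x: "x \<in> arcs (double Q)"
    have x': "x \<in> arcs (double (reverse_arrows X Q))" using x by (simp add: double_reverse)
    have "f (A x) = reverse_rep S (\<lambda>x. \<not> isl x) X (\<lambda>x. g (B x)) x"
      unfolding AB[OF x, symmetric] by (rule reverse_rep_hom[OF f repB fg x'])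
    also have "\<dots> = g (A x)"
      unfolding AB[OF x, symmetric] by (rule reverse_rep_hom[OF g repB refl x', symmetric])
    finally show "f (A x) = g (A x)" .
  qed
  then show ?thesis by (simp add: B_def)
qed

theorem theorem1p4:
  fixes Q :: "('v, 'e) pre_digraph"
    and X :: "'e set"
    and q :: "'v \<Rightarrow> 'k :: field"
    and r r' :: "('e + 'e) rel"
  assumes "fin_digraph Q"
    and "\<And>v. v \<in> verts Q \<Longrightarrow> q v \<noteq> 0"
    and "X \<subseteq> arcs Q"
    and "strict_linear_order_on (arcs (double Q)) r"
    and "strict_linear_order_on (arcs (double (reverse_arrows X Q))) r'"
  shows "alg_iso (mult_preproj Q r q) (mult_preproj (reverse_arrows X Q) r' q)"
proof -
  let ?Q' = "reverse_arrows X Q"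
  define xs ys where "xs = increasing_list (arcs (double Q)) r"
    and "ys = increasing_list (arcs (double ?Q')) r'"
  have fin: "finite (arcs (double Q))"
    using fin_digraph.finite_arcs[OF assms(1)] by (simp add: double_def)
  have xs: "set xs = arcs (double Q)" "distinct xs"
    unfolding xs_def by (rule increasing_list_props[OF fin assms(4)])+
  have ys: "set ys = arcs (double Q)" "distinct ys"
    using increasing_list_props[of "arcs (double ?Q')" r'] fin assms(5)
    by (simp_all add: ys_def double_reverse)
  have "\<exists>E A. mpp_universal Q q xs (mult_preproj Q r q) E A"
    by (rule mult_preproj_universal[OF assms(1) xs_def]) (simp add: xs(1))
  then obtain E A where "mpp_universal Q q xs (mult_preproj Q r q) E A" by blast
  then have rev: "mpp_universal ?Q' q (map (flip X) xs) (mult_preproj Q r q) E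
      (reverse_rep (mult_preproj Q r q) isl X A)"
    by (rule mpp_universal_reverse) (simp add: xs(1))
  have "inj (flip X)" by (rule inj_on_inverseI[of _ "flip X"]) simp
  then have "distinct (map (flip X) xs)"
    by (simp add: distinct_map xs(2) inj_on_subset[OF _ subset_UNIV])
  moreover have flip: "set (map (flip X) xs) = arcs (double Q)"
  proof
    show "arcs (double Q) \<subseteq> set (map (flip X) xs)"
    proof
      fix x assume "x \<in> arcs (double Q)"
      then have "flip X (flip X x) \<in> flip X ` arcs (double Q)" by (intro imageI) simp
      then show "x \<in> set (map (flip X) xs)" by (simp add: xs(1))
    qed
  qed (auto simp: xs(1))
  \<comment> \<open>The flipped list and \<open>ys\<close> enumerate the same arrows, so a
    permutation links them, however unrelated the orders \<open>r\<close> and \<open>r'\<close>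
    are.\<close>
  ultimately have "\<exists>B. mpp_universal ?Q' q ys (mult_preproj Q r q) E B"
    by (intro mpp_universal_permute[OF rev _ _ ys(2)])
      (simp_all only: flip ys(1) double_reverse subset_refl)
  then obtain B where B: "mpp_universal ?Q' q ys (mult_preproj Q r q) E B" by blast
  have "\<exists>E' A'. mpp_universal ?Q' q ys (mult_preproj ?Q' r' q) E' A'"
    by (rule mult_preproj_universal[OF fin_digraph_reverse[OF assms(1)] ys_def])
      (simp add: ys(1) double_reverse)
  then obtain E' A' where "mpp_universal ?Q' q ys (mult_preproj ?Q' r' q) E' A'" by blast
  with B show ?thesis by (rule mpp_universal_iso)
qed

end
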